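(* Among all unbalanced signed complete graphs of order $n$ whose negative edges form a spanning tree, let $\Sigma=(K_n,T^-)$ (with $T$ the spanning tree formed by the negative edges) be one that maximizes the spectral radius $\rho(A(\Sigma))$. Then: (I) if $n=5$, then $T\cong T_{1,2}$ or $T\cong P_5$; (II) if $n\ge 6$, then $T\cong T_{1,n-3}$.
   Context: A signed graph $\Sigma=(G,\sigma)$ is a simple connected graph $G=(V,E)$ together with $\sigma:E\to\{-1,1\}$; an edge $e$ is negative if $\sigma(e)=-1$. A cycle is positive if it contains an even number of negative edges and negative otherwise; $\Sigma$ is balanced if all its cycles are positive, and unbalanced otherwise. The adjacency matrix $A(\Sigma)$ has $(i,j)$ entry $\sigma(v_iv_j)$ if $v_i\sim v_j$ and $0$ otherwise; its eigenvalues are $\lambda_1(A(\Sigma))\ge\dots\ge\lambda_n(A(\Sigma))$, and $\rho(A(\Sigma))=\max\{\lambda_1(A(\Sigma)),-\lambda_n(A(\Sigma))\}$. $(K_n,H^-)$ denotes the signed complete graph on $n$ vertices whose negative edges are exactly the edges of the subgraph $H$. $T_{a,b}$ denotes the double star obtained from $P_2$ (a single edge) by attaching $a$ pendent vertices to one end vertex and $b$ pendent vertices to the other. $P_5$ is the path on $5$ vertices. *)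

theory Defs
  imports "Jordan_Normal_Form.Spectral_Radius"
begin

section \<open>Undirected graphs\<close>

text \<open>
  Edges are two-element sets of vertices. The symmetric digraphs of Graph-Theory are not used here:
  there both directions of a single edge already form a cycle, so that the notion of
  a tree available for digraphs does not describe undirected trees.
\<close>

record 'a ugraph =
  vertices :: "'a set"
  edges :: "'a set set"

definition simple_graph :: "'a ugraph \<Rightarrow> bool" where
  "simple_graph G \<longleftrightarrow> finite (vertices G) \<and> (\<forall>e\<in>edges G. e \<subseteq> vertices G \<and> card e = 2)"

definition adjacent :: "'a ugraph \<Rightarrow> 'a \<Rightarrow> 'a \<Rightarrow> bool" where
  "adjacent G u v \<longleftrightarrow> {u, v} \<in> edges G"

definition walk :: "'a ugraph \<Rightarrow> 'a list \<Rightarrow> bool" where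
  "walk G p \<longleftrightarrow> p \<noteq> [] \<and> set p \<subseteq> vertices G \<and> successively (adjacent G) p"

definition connected_graph :: "'a ugraph \<Rightarrow> bool" where
  "connected_graph G \<longleftrightarrow> vertices G \<noteq> {} \<and>
     (\<forall>u\<in>vertices G. \<forall>v\<in>vertices G. \<exists>p. walk G p \<and> hd p = u \<and> last p = v)"

text \<open>A cycle is given by its vertices in cyclic order, the first one not being repeated.\<close>

definition cycle :: "'a ugraph \<Rightarrow> 'a list \<Rightarrow> bool" where
  "cycle G p \<longleftrightarrow> 3 \<le> length p \<and> distinct p \<and> walk G p \<and> adjacent G (last p) (hd p)"

definition cycle_edges :: "'a list \<Rightarrow> 'a set set" where
  "cycle_edges p = insert {last p, hd p} {{p ! i, p ! Suc i} | i. Suc i < length p}"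

definition tree_graph :: "'a ugraph \<Rightarrow> bool" where
  "tree_graph G \<longleftrightarrow> simple_graph G \<and> connected_graph G \<and> (\<nexists>p. cycle G p)"

definition spanning_tree_of :: "'a ugraph \<Rightarrow> 'a ugraph \<Rightarrow> bool" where
  "spanning_tree_of T G \<longleftrightarrow> tree_graph T \<and> vertices T = vertices G \<and> edges T \<subseteq> edges G"

definition isomorphic :: "'a ugraph \<Rightarrow> 'b ugraph \<Rightarrow> bool" where
  "isomorphic G H \<longleftrightarrow> (\<exists>f. bij_betw f (vertices G) (vertices H) \<and>
     (\<forall>u\<in>vertices G. \<forall>v\<in>vertices G. adjacent G u v \<longleftrightarrow> adjacent H (f u) (f v)))"

definition complete_graph :: "nat \<Rightarrow> nat ugraph" where
  "complete_graph n = \<lparr>vertices = {..<n}, edges = {e. e \<subseteq> {..<n} \<and> card e = 2}\<rparr>"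

definition path_graph :: "nat \<Rightarrow> nat ugraph" where
  "path_graph n = \<lparr>vertices = {..<n}, edges = {{i, Suc i} | i. Suc i < n}\<rparr>"

text \<open>
  The double star: the ends of the central edge are \<open>0\<close> and \<open>1\<close>; the next \<open>a\<close> vertices are
  pendent at \<open>0\<close> and the last \<open>b\<close> vertices are pendent at \<open>1\<close>.
\<close>

definition double_star :: "nat \<Rightarrow> nat \<Rightarrow> nat ugraph" where
  "double_star a b = \<lparr>vertices = {..<a + b + 2},
     edges = {{0, 1}} \<union> {{0, i} | i. i \<in> {2..<a + 2}} \<union> {{1, j} | j. j \<in> {a + 2..<a + b + 2}}\<rparr>"


section \<open>Signed graphs\<close>

text \<open>The values of the sign function on sets that are not edges are irrelevant.\<close>

type_synonym 'a signed_graph = "'a ugraph \<times> ('a set \<Rightarrow> int)"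

definition wf_signed_graph :: "'a signed_graph \<Rightarrow> bool" where
  "wf_signed_graph S \<longleftrightarrow> simple_graph (fst S) \<and> connected_graph (fst S) \<and>
     (\<forall>e\<in>edges (fst S). snd S e \<in> {-1, 1})"

definition positive_cycle :: "'a signed_graph \<Rightarrow> 'a list \<Rightarrow> bool" where
  "positive_cycle S p \<longleftrightarrow> even (card {e \<in> cycle_edges p. snd S e = -1})"

definition balanced :: "'a signed_graph \<Rightarrow> bool" where
  "balanced S \<longleftrightarrow> (\<forall>p. cycle (fst S) p \<longrightarrow> positive_cycle S p)"

text \<open>The signed complete graph whose negative edges are exactly the edges of \<open>H\<close>.\<close>

definition signed_complete :: "nat \<Rightarrow> nat ugraph \<Rightarrow> nat signed_graph" where
  "signed_complete n H = (complete_graph n, \<lambda>e. if e \<in> edges H then -1 else 1)"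

lemma wf_signed_graph_signed_complete:
  assumes "n \<ge> 1"
  shows "wf_signed_graph (signed_complete n H)"
proof -
  have "\<exists>p. walk (complete_graph n) p \<and> hd p = u \<and> last p = v" if "u < n" "v < n" for u v
  proof (cases "u = v")
    case True
    then show ?thesis
      using that by (intro exI[of _ "[u]"]) (simp add: walk_def complete_graph_def)
  next
    case False
    then show ?thesis
      using that by (intro exI[of _ "[u, v]"]) (simp add: walk_def complete_graph_def adjacent_def)
  qed
  then have "connected_graph (complete_graph n)"
    using assms by (auto simp: connected_graph_def complete_graph_def lessThan_empty_iff)
  then show ?thesis
    by (auto simp: wf_signed_graph_def signed_complete_def simple_graph_def complete_graph_def)
qed

text \<open>For signed graphs whose vertices are \<open>0, \<dots>, n - 1\<close>, in this order.\<close>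

definition adjacency_matrix :: "nat signed_graph \<Rightarrow> real mat" where
  "adjacency_matrix S = (let n = card (vertices (fst S)) in
     mat n n (\<lambda>(i, j). if adjacent (fst S) i j then real_of_int (snd S {i, j}) else 0))"

text \<open>
  The largest and the smallest (real) eigenvalue. They are meant for real symmetric matrices of
  positive dimension, whose set of real eigenvalues is finite and nonempty.
\<close>

definition largest_eigenvalue :: "real mat \<Rightarrow> real" where
  "largest_eigenvalue A = Max (spectrum A)"

definition smallest_eigenvalue :: "real mat \<Rightarrow> real" where
  "smallest_eigenvalue A = Min (spectrum A)"

definition rho :: "real mat \<Rightarrow> real" where
  "rho A = max (largest_eigenvalue A) (- smallest_eigenvalue A)"

end

theory Submission
  imports Defs
begin

text \<open>
  Write \<open>\<rho>\<close> as an eigenvalue of \<open>\<plusminus>A\<close> and switch by the signs of an eigenvector, so that the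
  eigenvector becomes nonnegative. For \<open>n \<ge> 6\<close> either two of the switched negative edges share a vertex,
  or every vertex lies on a negative edge; in the latter case \<open>\<rho> \<le> n - 2\<close>. In the former case, pairing
  with the positive eigenvector for two adjacent negative edges \<open>u - w - v\<close> shows that \<open>\<rho>\<close> is at
  most the largest eigenvalue \<open>\<lambda>\<close> of that signed graph, with equality only if there are no other negative
  edges. Since \<open>T\<^bsub>1,n-3\<^esub>\<close> is switching equivalent to it and \<open>\<lambda> > n - 2\<close>, a maximizer attains equality, and the
  absence of short cycles then forces the tree. For \<open>n = 5\<close> only two trees are not stars, and stars are balanced.
\<close>

section \<open>Graphs\<close>

lemma adjacent_commute: "adjacent G u v \<longleftrightarrow> adjacent G v u"
  by (simp add: adjacent_def insert_commute)

lemma adjacent_irrefl: "simple_graph G \<Longrightarrow> \<not> adjacent G u u"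
  by (auto simp: simple_graph_def adjacent_def)

lemma adjacent_vertices:
  assumes "simple_graph G" "adjacent G u v"
  shows "u \<in> vertices G" "v \<in> vertices G"
  using assms by (auto simp: simple_graph_def adjacent_def)

lemma successively_crossing:
  assumes "successively P p" "p \<noteq> []" "hd p \<in> X" "last p \<notin> X"
  shows "\<exists>x y. x \<in> X \<and> y \<in> set p - X \<and> P x y"
  using assms
proof (induction p)
  case (Cons a p)
  then show ?case
    by (cases p) auto
qed simp

text \<open>Connectedness in the form used for trees below: a walk from \<open>X\<close> to a vertex
  outside \<open>X\<close> must take a step that leaves \<open>X\<close>.\<close>

lemma connected_graph_crossing:
  assumes "connected_graph G" "X \<subseteq> vertices G" "X \<noteq> {}" "v \<in> vertices G - X"
  obtains x y where "x \<in> X" "y \<in> vertices G - X" "adjacent G x y"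
proof -
  obtain u where u: "u \<in> X"
    using assms by auto
  then obtain p where p: "walk G p" "hd p = u" "last p = v"
    using assms unfolding connected_graph_def by blast
  then obtain x y where "x \<in> X" "y \<in> set p - X" "adjacent G x y"
    using successively_crossing[of "adjacent G" p X] u assms(4) unfolding walk_def by auto
  then show ?thesis
    using p that unfolding walk_def by blast
qed

section \<open>Edges of a cycle, indexed cyclically\<close>

lemma cycle_successor:
  assumes "cycle G p" "i < length p"
  shows "adjacent G (p ! i) (p ! (Suc i mod length p))"
proof (cases "Suc i < length p")
  case True
  then show ?thesis
    using assms successively_nth[of "adjacent G" p i]
    by (auto simp: cycle_def walk_def successively_conv_nth)
next
  case False
  then have "Suc i = length p"
    using assms by simp
  then show ?thesis
    using assms by (auto simp: cycle_def walk_def last_conv_nth hd_conv_nth simp flip: \<open>Suc i = length p\<close>)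
qed

text \<open>Indices modulo the length put the closing edge on the same footing as the
  others.\<close>

lemma cycle_edges_conv_nth:
  assumes "p \<noteq> []"
  shows "cycle_edges p = {{p ! i, p ! (Suc i mod length p)} |i. i < length p}"
proof -
  have "{p ! i, p ! (Suc i mod length p)} \<in> cycle_edges p" if "i < length p" for i
  proof (cases "Suc i < length p")
    case False
    then have "Suc i = length p"
      using that by simp
    then show ?thesis
      using assms by (auto simp: cycle_edges_def last_conv_nth hd_conv_nth simp flip: \<open>Suc i = length p\<close>)
  qed (auto simp: cycle_edges_def)
  moreover have "\<exists>i<length p. e = {p ! i, p ! (Suc i mod length p)}" if e: "e \<in> cycle_edges p" for e
  proof (cases "e = {last p, hd p}")
    case True
    then show ?thesis
      using assms by (intro exI[of _ "length p - 1"]) (simp add: last_conv_nth hd_conv_nth)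
  next
    case False
    then obtain i where "e = {p ! i, p ! Suc i}" "Suc i < length p"
      using e unfolding cycle_edges_def by blast
    then show ?thesis
      by (intro exI[of _ i]) auto
  qed
  ultimately show ?thesis
    by blast
qed

text \<open>The cyclic predecessor of \<open>m\<close>; it is written \<open>m + k - 1\<close>
  because \<open>m - 1\<close> would truncate at \<open>m = 0\<close>.\<close>

lemma Suc_mod_eq_iff:
  assumes "i < k" "m < (k::nat)"
  shows "Suc i mod k = m \<longleftrightarrow> i = (m + k - 1) mod k"
proof (cases "Suc i = k")
  case True
  then show ?thesis
    using assms by (cases m) (auto simp: mod_if)
next
  case False
  then show ?thesis
    using assms by (cases m) (auto simp: mod_if)
qed

text \<open>By distinctness, the vertex at position \<open>m\<close> lies only on the edges starting
  at \<open>m\<close> and at its cyclic predecessor \<open>l\<close>. Length at least 3 keeps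
  \<open>l\<close> and the successor \<open>r\<close> apart.\<close>

lemma cycle_edges_at_vertex:
  assumes p: "distinct p" "3 \<le> length p" and c: "c \<in> set p"
  obtains a b where "{e \<in> cycle_edges p. c \<in> e} = {{c, a}, {c, b}}" "a \<in> set p" "b \<in> set p" "a \<noteq> b"
    "a \<noteq> c" "b \<noteq> c"
proof -
  define k where "k = length p"
  obtain m where m: "m < k" "c = p ! m"
    using c unfolding in_set_conv_nth k_def by blast
  define l where "l = (m + k - 1) mod k"
  define r where "r = Suc m mod k"
  have k: "k \<ge> 3"
    using p k_def by simp
  have lr: "l < k" "r < k" "l \<noteq> m" "r \<noteq> m" "l \<noteq> r"
    using m k by (auto simp: l_def r_def mod_if split: if_splits)
  have l: "Suc l mod k = m"
    using lr m Suc_mod_eq_iff[of l k m] by (simp add: l_def)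
  have E: "cycle_edges p = {{p ! i, p ! (Suc i mod k)} |i. i < k}"
    unfolding k_def using p by (intro cycle_edges_conv_nth) auto
  have "c = p ! i \<longleftrightarrow> i = m" if "i < k" for i
    using that m p nth_eq_iff_index_eq[of p m i] by (auto simp: k_def)
  moreover have "Suc i mod k < k" for i
    using k by simp
  ultimately have mem: "c \<in> {p ! i, p ! (Suc i mod k)} \<longleftrightarrow> i = m \<or> i = l" if "i < k" for i
    using that Suc_mod_eq_iff[OF that m(1)] by (auto simp: l_def)
  have "{e \<in> cycle_edges p. c \<in> e} = {{c, p ! l}, {c, p ! r}}"
  proof
    show "{e \<in> cycle_edges p. c \<in> e} \<subseteq> {{c, p ! l}, {c, p ! r}}"
    proof
      fix e assume "e \<in> {e \<in> cycle_edges p. c \<in> e}"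
      then obtain i where "i < k" "e = {p ! i, p ! (Suc i mod k)}" "c \<in> e"
        unfolding E by blast
      then show "e \<in> {{c, p ! l}, {c, p ! r}}"
        using mem[of i] l m r_def by auto
    qed
    have "{c, p ! r} \<in> cycle_edges p" "{p ! l, c} \<in> cycle_edges p"
      unfolding E using m lr l r_def by blast+
    then show "{{c, p ! l}, {c, p ! r}} \<subseteq> {e \<in> cycle_edges p. c \<in> e}"
      by (auto simp: insert_commute)
  qed
  moreover have "p ! l \<noteq> p ! r" "p ! l \<noteq> c" "p ! r \<noteq> c"
    using lr m p by (auto simp: k_def nth_eq_iff_index_eq)
  ultimately show ?thesis
    using that lr k_def by auto
qed

lemma cycle_edges_adjacent:
  assumes "cycle G p" "{u, v} \<in> cycle_edges p"
  shows "adjacent G u v"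
proof -
  have "p \<noteq> []"
    using assms by (auto simp: cycle_def)
  then obtain i where "i < length p" "{u, v} = {p ! i, p ! (Suc i mod length p)}"
    using assms(2) unfolding cycle_edges_conv_nth[OF \<open>p \<noteq> []\<close>] by blast
  then show ?thesis
    using cycle_successor[OF assms(1)] unfolding adjacent_def by metis
qed

lemma cycle_two_neighbours:
  assumes "cycle G p" "v \<in> set p"
  obtains a b where "a \<in> set p" "b \<in> set p" "a \<noteq> b" "adjacent G v a" "adjacent G v b"
proof -
  have "distinct p" "3 \<le> length p"
    using assms by (auto simp: cycle_def)
  then obtain a b where "{e \<in> cycle_edges p. v \<in> e} = {{v, a}, {v, b}}" "a \<in> set p" "b \<in> set p" "a \<noteq> b"
    using cycle_edges_at_vertex assms(2) by metis
  then show ?thesis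
    using that[of a b] cycle_edges_adjacent[OF assms(1)] by blast
qed

text \<open>The negative edges of a cycle are its edges through \<open>c\<close>: two of them if the
  cycle visits \<open>c\<close>, none otherwise.\<close>

lemma star_balanced:
  assumes "\<And>e. e \<in> edges T \<longleftrightarrow> e \<subseteq> {..<n} \<and> card e = 2 \<and> c \<in> e"
  shows "balanced (signed_complete n T)"
  unfolding balanced_def
proof (intro allI impI)
  fix p assume "cycle (fst (signed_complete n T)) p"
  then have cyc: "cycle (complete_graph n) p"
    by (simp add: signed_complete_def)
  then have p: "distinct p" "3 \<le> length p" "set p \<subseteq> {..<n}"
    by (auto simp: cycle_def walk_def complete_graph_def)
  have edge: "e \<subseteq> {..<n} \<and> card e = 2" if e: "e \<in> cycle_edges p" for e
  proof -
    have "p \<noteq> []" using p by auto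
    then obtain u v where "e = {u, v}"
      using e unfolding cycle_edges_conv_nth[OF \<open>p \<noteq> []\<close>] by blast
    then show ?thesis
      using cycle_edges_adjacent[OF cyc] e by (auto simp: adjacent_def complete_graph_def)
  qed
  have eq: "{e \<in> cycle_edges p. snd (signed_complete n T) e = -1} = {e \<in> cycle_edges p. c \<in> e}"
    using assms edge by (auto simp: signed_complete_def)
  have "even (card {e \<in> cycle_edges p. c \<in> e})"
  proof (cases "c \<in> set p")
    case True
    then obtain a b where "{e \<in> cycle_edges p. c \<in> e} = {{c, a}, {c, b}}" "a \<noteq> b"
      using cycle_edges_at_vertex p by metis
    then show ?thesis
      by (auto simp: doubleton_eq_iff card_insert_if)
  next
    case False
    have "c \<notin> e" if "e \<in> cycle_edges p" for e
    proof -
      have "p \<noteq> []" using p by auto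
      then show ?thesis
        using that False unfolding cycle_edges_conv_nth[OF \<open>p \<noteq> []\<close>]
        by (auto dest!: nth_mem)
    qed
    then have "{e \<in> cycle_edges p. c \<in> e} = {}"
      by blast
    then show ?thesis
      by (simp only: card.empty even_zero)
  qed
  then show "positive_cycle (signed_complete n T) p"
    unfolding positive_cycle_def eq .
qed

section \<open>Eigenvalues\<close>

text \<open>Trades vectors for functions on indices, so that all later arguments are about finite
  sums. It serves both real and complex matrices.\<close>

lemma eigenvalue_iff_sum:
  assumes "A \<in> carrier_mat n n"
  shows "eigenvalue A k \<longleftrightarrow>
    (\<exists>x. (\<exists>i<n. x i \<noteq> 0) \<and> (\<forall>i<n. (\<Sum>j<n. A $$ (i, j) * x j) = k * x i))"
proof
  assume "eigenvalue A k"
  then obtain v where v: "v \<in> carrier_vec n" "v \<noteq> 0\<^sub>v n" "A *\<^sub>v v = k \<cdot>\<^sub>v v"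
    using assms by (auto simp: eigenvalue_def eigenvector_def)
  have "\<exists>i<n. v $ i \<noteq> 0"
    using v(1,2) by auto
  moreover have "(\<Sum>j<n. A $$ (i, j) * v $ j) = k * v $ i" if "i < n" for i
  proof -
    have "(A *\<^sub>v v) $ i = (\<Sum>j<n. A $$ (i, j) * v $ j)"
      using that assms v(1) by (auto simp: scalar_prod_def lessThan_atLeast0 intro!: sum.cong)
    then show ?thesis
      using v that by simp
  qed
  ultimately show "\<exists>x. (\<exists>i<n. x i \<noteq> 0) \<and> (\<forall>i<n. (\<Sum>j<n. A $$ (i, j) * x j) = k * x i)"
    by (intro exI[of _ "\<lambda>i. v $ i"]) blast
next
  assume "\<exists>x. (\<exists>i<n. x i \<noteq> 0) \<and> (\<forall>i<n. (\<Sum>j<n. A $$ (i, j) * x j) = k * x i)"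
  then obtain x i where x: "i < n" "x i \<noteq> 0"
    "\<And>i. i < n \<Longrightarrow> (\<Sum>j<n. A $$ (i, j) * x j) = k * x i"
    by blast
  have "vec n x \<noteq> 0\<^sub>v n"
  proof
    assume "vec n x = 0\<^sub>v n"
    then have "vec n x $ i = 0\<^sub>v n $ i"
      by simp
    then show False
      using x(1,2) by simp
  qed
  moreover have "A *\<^sub>v vec n x = k \<cdot>\<^sub>v vec n x"
  proof (rule eq_vecI)
    fix i assume "i < dim_vec (k \<cdot>\<^sub>v vec n x)"
    then have i: "i < n"
      by simp
    have "(A *\<^sub>v vec n x) $ i = (\<Sum>j<n. A $$ (i, j) * x j)"
      using i assms by (auto simp: scalar_prod_def lessThan_atLeast0 intro!: sum.cong)
    then show "(A *\<^sub>v vec n x) $ i = (k \<cdot>\<^sub>v vec n x) $ i"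
      using x(3) i by simp
  qed (use assms in auto)
  ultimately have "eigenvector A (vec n x) k"
    using assms by (auto simp: eigenvector_def)
  then show "eigenvalue A k"
    unfolding eigenvalue_def by blast
qed

text \<open>An eigenvalue \<open>k\<close> exists over the complex numbers. The Hermitian form at an
  eigenvector is real by symmetry, so \<open>k\<close> is real, and the real or the imaginary part
  of the eigenvector is a real eigenvector.\<close>

lemma symmetric_real_spectrum_non_empty:
  fixes A :: "real mat"
  assumes A: "A \<in> carrier_mat n n" and "n > 0"
    and sym: "\<And>i j. i < n \<Longrightarrow> j < n \<Longrightarrow> A $$ (i, j) = A $$ (j, i)"
  shows "spectrum A \<noteq> {}"
proof -
  define a where "a i j = A $$ (i, j)" for i j
  define C where "C = map_mat complex_of_real A"
  have C: "C \<in> carrier_mat n n"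
    using A by (simp add: C_def)
  then obtain k where "eigenvalue C k"
    using spectrum_non_empty[OF C \<open>n > 0\<close>] by (auto simp: spectrum_def)
  then obtain z m where m: "m < n" "z m \<noteq> 0"
    and "\<And>i. i < n \<Longrightarrow> (\<Sum>j<n. C $$ (i, j) * z j) = k * z i"
    unfolding eigenvalue_iff_sum[OF C] by blast
  then have z: "(\<Sum>j<n. complex_of_real (a i j) * z j) = k * z i" if "i < n" for i
    using that A by (simp add: C_def a_def)
  define S where "S = (\<Sum>i<n. cnj (z i) * (\<Sum>j<n. complex_of_real (a i j) * z j))"
  have sq: "cnj w * w = complex_of_real ((cmod w)\<^sup>2)" for w
    by (metis complex_norm_square mult.commute)
  have "S = (\<Sum>i<n. k * (cnj (z i) * z i))"
    unfolding S_def by (intro sum.cong) (auto simp: z)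
  then have S: "S = k * complex_of_real (\<Sum>i<n. (cmod (z i))\<^sup>2)"
    by (simp only: sq of_real_sum sum_distrib_left)
  \<comment> \<open>Conjugation followed by exchanging the two sums gives back \<open>S\<close>,
    since the matrix is real and symmetric.\<close>
  have "cnj S = (\<Sum>i<n. \<Sum>j<n. z i * (complex_of_real (a i j) * cnj (z j)))"
    by (simp add: S_def sum_distrib_left)
  also have "\<dots> = (\<Sum>j<n. \<Sum>i<n. z i * (complex_of_real (a i j) * cnj (z j)))"
    by (rule sum.swap)
  also have "\<dots> = S"
    unfolding S_def sum_distrib_left using sym by (intro sum.cong) (auto simp: a_def)
  finally have "cnj k * complex_of_real (\<Sum>i<n. (cmod (z i))\<^sup>2) =
      k * complex_of_real (\<Sum>i<n. (cmod (z i))\<^sup>2)"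
    unfolding S by simp
  moreover have "(\<Sum>i<n. (cmod (z i))\<^sup>2) > 0"
    using m by (intro sum_pos2[of _ m]) auto
  ultimately have "cnj k = k"
    by (metis mult_cancel_right of_real_eq_0_iff less_irrefl)
  then have k: "k = complex_of_real (Re k)"
    by (simp add: complex_eq_iff)
  have "(\<Sum>j<n. a i j * Re (z j)) = Re k * Re (z i)" "(\<Sum>j<n. a i j * Im (z j)) = Re k * Im (z i)"
    if "i < n" for i
    using arg_cong[OF z[OF that], of Re] arg_cong[OF z[OF that], of Im] k
    by (simp_all add: complex_eq_iff)
  moreover have "Re (z m) \<noteq> 0 \<or> Im (z m) \<noteq> 0"
    using m by (simp add: complex_eq_iff)
  \<comment> \<open>Either \<open>Re\<close> or \<open>Im\<close> of \<open>z\<close>, whichever is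
    nonzero at \<open>m\<close>.\<close>
  ultimately obtain x where "x m \<noteq> 0" "\<And>i. i < n \<Longrightarrow> (\<Sum>j<n. a i j * x j) = Re k * x i"
    by metis
  then have "eigenvalue A (Re k)"
    unfolding eigenvalue_iff_sum[OF A] a_def using m(1) by (intro exI[of _ x]) auto
  then show ?thesis
    by (auto simp: spectrum_def)
qed

text \<open>The maximum and minimum of the finite nonempty spectrum are attained. The sign
  \<open>\<sigma>\<close> is 1 if the largest eigenvalue gives \<open>rho A\<close> and -1 if the
  smallest one does, so \<open>rho A\<close> is an eigenvalue of
  \<open>\<sigma> * A\<close>.\<close>

lemma rho_attained:
  fixes A :: "real mat"
  assumes A: "A \<in> carrier_mat n n" and n: "n > 0"
    and sym: "\<And>i j. i < n \<Longrightarrow> j < n \<Longrightarrow> A $$ (i, j) = A $$ (j, i)"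
  obtains \<sigma> :: real and x where "\<sigma> = 1 \<or> \<sigma> = -1" "\<exists>i<n. x i \<noteq> 0"
    "\<And>i. i < n \<Longrightarrow> (\<Sum>j<n. \<sigma> * A $$ (i, j) * x j) = rho A * x i"
proof -
  have fin: "finite (spectrum A)" and ne: "spectrum A \<noteq> {}"
    using card_finite_spectrum(1)[OF A] symmetric_real_spectrum_non_empty[OF assms] by auto
  have "largest_eigenvalue A \<in> spectrum A" "smallest_eigenvalue A \<in> spectrum A"
    using fin ne by (simp_all add: largest_eigenvalue_def smallest_eigenvalue_def)
  moreover have "rho A = 1 * largest_eigenvalue A \<or> rho A = -1 * smallest_eigenvalue A"
    by (simp add: rho_def max_def)
  ultimately obtain \<sigma> \<mu> where \<sigma>: "\<sigma> = 1 \<or> \<sigma> = -1" "eigenvalue A \<mu>" "rho A = \<sigma> * \<mu>"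
    unfolding spectrum_def by blast
  then obtain x where "\<exists>i<n. x i \<noteq> 0" "\<And>i. i < n \<Longrightarrow> (\<Sum>j<n. A $$ (i, j) * x j) = \<mu> * x i"
    unfolding eigenvalue_iff_sum[OF A] by blast
  then show ?thesis
    using that[of \<sigma> x] \<sigma> by (simp add: mult.assoc flip: sum_distrib_left)
qed

lemma eigenvalue_le_rho:
  assumes "A \<in> carrier_mat n n" "eigenvalue A k"
  shows "k \<le> rho A"
  using assms card_finite_spectrum(1)[OF assms(1)]
  by (auto simp: rho_def largest_eigenvalue_def spectrum_def le_max_iff_disj)

lemma adjacency_matrix_signed_complete:
  "adjacency_matrix (signed_complete n T) =
     mat n n (\<lambda>(i, j). if i = j then 0 else if adjacent T i j then -1 else 1)"
  by (rule eq_matI)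
    (auto simp: adjacency_matrix_def signed_complete_def complete_graph_def adjacent_def Let_def)

section \<open>Comparison with two adjacent negative edges\<close>

text \<open>The path u - w - v with middle vertex \<open>w\<close>, as a symmetric relation, so that
  it can stand in for a set of negative pairs.\<close>

definition cherry :: "'a \<Rightarrow> 'a \<Rightarrow> 'a \<Rightarrow> 'a \<Rightarrow> 'a \<Rightarrow> bool" where
  "cherry w u v i j \<longleftrightarrow> i = w \<and> (j = u \<or> j = v) \<or> j = w \<and> (i = u \<or> i = v)"

lemma sum_cherry:
  fixes x :: "'a \<Rightarrow> real"
  assumes "finite V" "w \<in> V" "u \<in> V" "v \<in> V" "distinct [w, u, v]"
  shows "(\<Sum>j | j \<in> V \<and> cherry w u v i j. x j) =
    (if i = w then x u + x v else if i = u \<or> i = v then x w else 0)"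
proof -
  have "{j. j \<in> V \<and> cherry w u v i j} = (if i = w then {u, v} else if i = u \<or> i = v then {w} else {})"
    using assms by (auto simp: cherry_def)
  then show ?thesis
    using assms by simp
qed

text \<open>
  Eliminating the three values of an eigenvector that is constant on the orbits of the cherry gives
  this cubic for \<open>L = \<lambda> + 1\<close>, where \<open>\<lambda>\<close> is the largest eigenvalue.
\<close>

definition threshold :: "nat \<Rightarrow> real \<Rightarrow> bool" where
  "threshold n L \<longleftrightarrow> L > real n - 1 \<and> (L - (real n - 1)) * (L\<^sup>2 - 8) = (L - 4)\<^sup>2"

text \<open>Intermediate values on the interval from n - 1 to n. At the left end the difference of
  the two sides is -(n - 5)^2, which is nonzero, so the root lies strictly to the right of n -
  1.\<close>

lemma threshold_exists:
  assumes "n \<ge> 6"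
  shows "\<exists>L. threshold n L"
proof -
  define f where "f L = (L - (real n - 1)) * (L\<^sup>2 - 8) - (L - 4)\<^sup>2" for L
  have "f (real n - 1) = - ((real n - 5)\<^sup>2)" "f (real n) = 8 * real n - 24"
    by (simp_all add: f_def power2_eq_square algebra_simps)
  then have "f (real n - 1) \<le> 0" "f (real n) \<ge> 0"
    using assms by simp_all
  moreover have "continuous_on {real n - 1..real n} f"
    unfolding f_def by (intro continuous_intros)
  ultimately obtain L where L: "real n - 1 \<le> L" "f L = 0"
    using IVT'[of f "real n - 1" 0 "real n"] by auto
  moreover have "L \<noteq> real n - 1"
    using L assms by (auto simp: f_def)
  ultimately show ?thesis
    unfolding threshold_def f_def by (intro exI[of _ L]) auto
qed

text \<open>With J the all-ones matrix and N the indicator of the negative pairs, A + I = J - 2N;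
  the equation says that \<open>y\<close> is an eigenvector of A + I for \<open>L\<close>, that is,
  of A for \<open>L - 1\<close>.\<close>

lemma cherry_positive_eigenvector:
  assumes "finite V" "w \<in> V" "u \<in> V" "v \<in> V" "distinct [w, u, v]"
    and n: "card V = n" "n \<ge> 6" and L: "threshold n L"
  obtains y :: "'a \<Rightarrow> real" where "\<And>i. i \<in> V \<Longrightarrow> y i > 0"
    "\<And>i. i \<in> V \<Longrightarrow> L * y i = sum y V - 2 * (\<Sum>j | j \<in> V \<and> cherry w u v i j. y j)"
proof -
  \<comment> \<open>Normalising the total to 1, the equations away from \<open>w\<close> give 1 / L
    at ordinary vertices and (1 - 2r) / L at the two ends, where r is the value at \<open>w\<close>.
    The equation at \<open>w\<close> then reads r (L^2 - 8) = L - 4.\<close>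
  define r where "r = (L - 4) / (L\<^sup>2 - 8)"
  define y where "y i = (if i = w then r else if i = u \<or> i = v then (1 - 2 * r) / L else 1 / L)" for i
  have L5: "L > 5"
    using L n by (simp add: threshold_def)
  have "L * L > 5 * 5"
    using L5 by (intro mult_strict_mono) auto
  then have L8: "L\<^sup>2 - 8 > 0"
    by (simp add: power2_eq_square)
  have r: "r * (L\<^sup>2 - 8) = L - 4"
    using L8 by (simp add: r_def)
  have "r * (L - 4) * (L\<^sup>2 - 8) = (L - 4) * (r * (L\<^sup>2 - 8))"
    by (simp only: mult_ac)
  also have "\<dots> = (L - (real n - 1)) * (L\<^sup>2 - 8)"
    using L unfolding r threshold_def by (simp only: power2_eq_square[of "L - 4"])
  finally have "r * (L - 4) * (L\<^sup>2 - 8) = (L - (real n - 1)) * (L\<^sup>2 - 8)" .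
  \<comment> \<open>This is where the cubic enters; it is exactly the condition that the entries of
    \<open>y\<close> sum to 1.\<close>
  then have rn: "r * (L - 4) = L - (real n - 1)"
    using L8 by simp
  have "2 * L < L * L"
    using L5 by simp
  then have "2 * (L - 4) < L\<^sup>2 - 8"
    by (simp add: power2_eq_square)
  \<comment> \<open>These two bounds are the positivity of \<open>y\<close> at the middle vertex and
    at the ends.\<close>
  then have r_bounds: "0 < r" "r < 1 / 2"
    using L5 L8 by (auto simp: r_def field_simps)
  have "sum y V = (\<Sum>i\<in>V - {w, u, v}. y i) + (\<Sum>i\<in>{w, u, v}. y i)"
    using assms by (intro sum.subset_diff) auto
  also have "(\<Sum>i\<in>V - {w, u, v}. y i) = (\<Sum>i\<in>V - {w, u, v}. 1 / L)"
    by (intro sum.cong) (auto simp: y_def)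
  also have "\<dots> = (real n - 3) / L"
    using assms by (simp add: card_Diff_subset)
  also have "(\<Sum>i\<in>{w, u, v}. y i) = r + 2 * ((1 - 2 * r) / L)"
    using assms(5) by (auto simp: y_def)
  also have "(real n - 3) / L + (r + 2 * ((1 - 2 * r) / L)) = (real n - 1 + r * (L - 4)) / L"
    using L5 by (simp add: field_simps)
  also have "\<dots> = 1"
    using L5 rn by simp
  finally have s: "sum y V = 1" .
  have y_uv: "y u = (1 - 2 * r) / L" "y v = (1 - 2 * r) / L"
    using assms(5) by (auto simp: y_def)
  have "L * y i = sum y V - 2 * (\<Sum>j | j \<in> V \<and> cherry w u v i j. y j)" for i
  proof (cases "i = w")
    case True
    have "1 - 2 * ((1 - 2 * r) / L + (1 - 2 * r) / L) = (r * (L\<^sup>2 - 8) + 8 * r) / L"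
      using L5 unfolding r by (simp add: field_simps)
    also have "\<dots> = (L * r) * L / L"
      by (simp add: power2_eq_square algebra_simps)
    also have "\<dots> = L * y i"
      using L5 True by (simp add: y_def)
    finally have "L * y i = 1 - 2 * ((1 - 2 * r) / L + (1 - 2 * r) / L)" ..
    then show ?thesis
      unfolding sum_cherry[OF assms(1-5)] s by (simp only: True if_True y_uv refl)
  next
    case False
    then show ?thesis
      using assms(5) L5 unfolding sum_cherry[OF assms(1-5)] s by (auto simp: y_def)
  qed
  moreover have "y i > 0" for i
    using r_bounds L5 by (simp add: y_def)
  ultimately show ?thesis
    using that by blast
qed

text \<open>
  Pairing \<open>x\<close> with the positive eigenvector \<open>y\<close> of the cherry bounds the eigenvalue; if the bound
  is attained then \<open>x\<close> is itself an eigenvector of the cherry, hence positive, and so no further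
  negative edge can occur.
\<close>

lemma cherry_dominates:
  fixes x :: "'a \<Rightarrow> real"
  assumes V: "finite V" "w \<in> V" "u \<in> V" "v \<in> V" "distinct [w, u, v]"
    and n: "card V = n" "n \<ge> 6" and L: "threshold n L" "L \<le> R"
    and sym: "\<And>i j. N i j \<longleftrightarrow> N j i" and N: "N w u" "N w v"
    and x: "\<And>i. i \<in> V \<Longrightarrow> x i \<ge> 0" "m \<in> V" "x m > 0"
    and eig: "\<And>i. i \<in> V \<Longrightarrow> R * x i = sum x V - 2 * (\<Sum>j | j \<in> V \<and> N i j. x j)"
    and ij: "i \<in> V" "j \<in> V"
  shows "N i j \<longleftrightarrow> cherry w u v i j"
proof -
  let ?P = "cherry w u v"
  obtain y where y: "\<And>i. i \<in> V \<Longrightarrow> y i > 0"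
    "\<And>i. i \<in> V \<Longrightarrow> L * y i = sum y V - 2 * (\<Sum>j | j \<in> V \<and> ?P i j. y j)"
    using cherry_positive_eigenvector[OF V n L(1)] by blast
  have P_sym: "?P i j \<longleftrightarrow> ?P j i" for i j
    by (auto simp: cherry_def)
  have PN: "?P i j \<Longrightarrow> N i j" for i j
    using N sym by (auto simp: cherry_def)
  \<comment> \<open>The contribution of the negative pairs outside the cherry.\<close>
  define D where "D i = (\<Sum>j | j \<in> V \<and> N i j \<and> \<not> ?P i j. x j)" for i
  have D_nonneg: "D i \<ge> 0" for i
    using x by (auto simp: D_def intro: sum_nonneg)
  have N_split: "(\<Sum>j | j \<in> V \<and> N i j. x j) = (\<Sum>j | j \<in> V \<and> ?P i j. x j) + D i" for i
  proof -
    have "{j. j \<in> V \<and> N i j} = {j. j \<in> V \<and> ?P i j} \<union> {j. j \<in> V \<and> N i j \<and> \<not> ?P i j}"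
      using PN by auto
    then show ?thesis
      unfolding D_def using V(1) by (simp only:) (intro sum.union_disjoint, auto)
  qed
  have ind: "(\<Sum>j | j \<in> V \<and> Q j. f j) = (\<Sum>j\<in>V. if Q j then f j else 0)" for Q and f :: "'a \<Rightarrow> real"
    using V(1) by (simp add: sum.inter_filter)
  have "(\<Sum>i\<in>V. y i * (\<Sum>j | j \<in> V \<and> ?P i j. x j)) = (\<Sum>i\<in>V. \<Sum>j\<in>V. if ?P i j then y i * x j else 0)"
    unfolding ind sum_distrib_left by (intro sum.cong) auto
  also have "\<dots> = (\<Sum>j\<in>V. \<Sum>i\<in>V. if ?P i j then y i * x j else 0)"
    by (rule sum.swap)
  also have "\<dots> = (\<Sum>i\<in>V. (\<Sum>j | j \<in> V \<and> ?P i j. y j) * x i)"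
    unfolding ind sum_distrib_right by (intro sum.cong) (auto simp: P_sym)
  finally have swap: "(\<Sum>i\<in>V. y i * (\<Sum>j | j \<in> V \<and> ?P i j. x j)) = \<dots>" .
  have "R * (\<Sum>i\<in>V. y i * x i) = (\<Sum>i\<in>V. y i * (R * x i))"
    by (simp add: sum_distrib_left mult_ac)
  also have "\<dots> = (\<Sum>i\<in>V. y i * sum x V - 2 * (y i * (\<Sum>j | j \<in> V \<and> ?P i j. x j)) - 2 * (y i * D i))"
    by (intro sum.cong) (auto simp: eig N_split algebra_simps)
  also have "\<dots> = sum y V * sum x V - 2 * (\<Sum>i\<in>V. (\<Sum>j | j \<in> V \<and> ?P i j. y j) * x i)
      - 2 * (\<Sum>i\<in>V. y i * D i)"
    by (simp add: sum_subtractf swap flip: sum_distrib_left sum_distrib_right)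
  finally have R: "R * (\<Sum>i\<in>V. y i * x i) = \<dots>" .
  have "L * (\<Sum>i\<in>V. y i * x i) = (\<Sum>i\<in>V. L * y i * x i)"
    by (simp add: sum_distrib_left mult_ac)
  also have "\<dots> = (\<Sum>i\<in>V. sum y V * x i - 2 * ((\<Sum>j | j \<in> V \<and> ?P i j. y j) * x i))"
    by (intro sum.cong) (auto simp: y(2) algebra_simps)
  also have "\<dots> = sum y V * sum x V - 2 * (\<Sum>i\<in>V. (\<Sum>j | j \<in> V \<and> ?P i j. y j) * x i)"
    by (simp add: sum_subtractf flip: sum_distrib_left)
  \<comment> \<open>The left side is nonnegative and the right side nonpositive, so both vanish:
    \<open>R = L\<close>, and \<open>D\<close> is zero on \<open>V\<close> because \<open>y\<close>
    is positive.\<close>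
  finally have RL: "(R - L) * (\<Sum>i\<in>V. y i * x i) = - 2 * (\<Sum>i\<in>V. y i * D i)"
    using R by (simp add: algebra_simps)
  have pos: "(\<Sum>i\<in>V. y i * x i) > 0"
    using V(1) x y(1) by (intro sum_pos2[of _ m]) (auto simp: less_imp_le)
  have D_sum: "(\<Sum>i\<in>V. y i * D i) \<ge> 0"
    using y(1) D_nonneg by (intro sum_nonneg) (auto simp: less_imp_le)
  have "0 \<le> (R - L) * (\<Sum>i\<in>V. y i * x i)"
    using L(2) pos by (intro mult_nonneg_nonneg) auto
  then have D0: "(\<Sum>i\<in>V. y i * D i) = 0"
    using RL D_sum by linarith
  then have RL': "R = L"
    using RL pos by simp
  have D: "D i = 0" if "i \<in> V" for i
  proof -
    have "y i * D i = 0"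
      using D0 sum_nonneg_eq_0_iff[of V "\<lambda>i. y i * D i"] that V(1) y(1) D_nonneg
      by (simp add: less_imp_le)
    then show ?thesis
      using y(1)[OF that] by simp
  qed
  have x_eq: "L * x i = sum x V - 2 * (if i = w then x u + x v else if i = u \<or> i = v then x w else 0)"
    if "i \<in> V" for i
    using eig[OF that] by (simp add: N_split D[OF that] RL' sum_cherry[OF V])
  have L5: "L > 5"
    using L n by (simp add: threshold_def)
  have s: "sum x V > 0"
    using V(1) x by (intro sum_pos2[of _ m]) auto
  have Lx: "5 * x i \<le> L * x i" if "i \<in> V" for i
    using L5 x(1)[OF that] by (intro mult_right_mono) auto
  \<comment> \<open>A zero at an ordinary vertex makes the total s zero. A zero at \<open>w\<close>
    gives s = 2 (x u + x v) with x u and x v at most s / 5; a zero at an end gives s = 2 x w with x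
    w at most s / 5.\<close>
  have x_pos: "x i > 0" if "i \<in> V" for i
  proof (rule ccontr)
    assume "\<not> x i > 0"
    then have "x i = 0"
      using x(1)[OF that] by simp
    then show False
      using x_eq[OF that] x_eq[OF V(2)] x_eq[OF V(3)] x_eq[OF V(4)] Lx[OF V(2)] Lx[OF V(3)]
        Lx[OF V(4)] x(1)[OF V(2)] x(1)[OF V(3)] x(1)[OF V(4)] V(5) s
      by (auto split: if_splits)
  qed
  show ?thesis
  proof (rule ccontr)
    assume "\<not> ?thesis"
    then have "j \<in> {j. j \<in> V \<and> N i j \<and> \<not> ?P i j}"
      using PN ij by auto
    then have "D i > 0"
      unfolding D_def using V(1) x_pos ij by (intro sum_pos2[of _ j]) (auto simp: less_imp_le)
    then show False
      using D ij by simp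
  qed
qed

text \<open>Take a largest entry x k and a negative neighbour j of k. Already subtracting x j once
  from the total leaves n - 1 terms, each at most x k. With \<open>R = rho + 1\<close> this is the
  bound n - 2 on the spectral radius.\<close>

lemma negative_neighbour_bound:
  fixes x :: "'a \<Rightarrow> real"
  assumes V: "finite V" "card V = n"
    and x: "\<And>i. i \<in> V \<Longrightarrow> x i \<ge> 0" "m \<in> V" "x m > 0"
    and eig: "\<And>i. i \<in> V \<Longrightarrow> R * x i = sum x V - 2 * (\<Sum>j | j \<in> V \<and> N i j. x j)"
    and N: "\<And>i. i \<in> V \<Longrightarrow> \<exists>j\<in>V. j \<noteq> i \<and> N i j"
  shows "R \<le> real n - 1"
proof -
  have "Max (x ` V) \<in> x ` V"
    using V x(2) by (intro Max_in) auto
  then obtain k where k: "k \<in> V" "x k = Max (x ` V)"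
    by auto
  have le: "x i \<le> x k" if "i \<in> V" for i
    using that V k(2) by simp
  then have pos: "x k > 0"
    using x by force
  obtain j where j: "j \<in> V" "j \<noteq> k" "N k j"
    using N k by blast
  have "(\<Sum>j | j \<in> V \<and> N k j. x j) \<ge> x j"
    using V(1) x(1) j by (intro member_le_sum) auto
  then have "R * x k \<le> sum x V - x j"
    using eig[OF k(1)] x(1)[OF j(1)] by linarith
  also have "\<dots> = sum x (V - {j})"
    using V(1) j by (simp add: sum_diff1)
  also have "\<dots> \<le> real (card (V - {j})) * x k"
    using le by (intro sum_bounded_above) auto
  also have "\<dots> = (real n - 1) * x k"
    using V j by (cases n) auto
  finally show ?thesis
    using pos by simp
qed

section \<open>Double stars\<close>

lemma adjacent_double_star:
  "adjacent (double_star 1 b) i j \<longleftrightarrow>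
     {i, j} = {0, 1} \<or> {i, j} = {0, 2} \<or> (\<exists>k\<in>{3..<b + 3}. {i, j} = {1, k})"
proof -
  have eq: "{{0, i} |i. i \<in> {2..<1 + 2}} = {{0, 2 :: nat}}" "{1 + 2..<1 + b + 2} = {3..<b + 3}"
    by auto
  have "edges (double_star 1 b) = {{0, 1}} \<union> {{0, 2}} \<union> {{1, k} |k. k \<in> {3..<b + 3}}"
    by (simp only: double_star_def eq ugraph.select_convs)
  then show ?thesis
    unfolding adjacent_def Bex_def
    by (simp only: Un_iff singleton_iff mem_Collect_eq disj_assoc conj_commute)
qed

text \<open>The vertex \<open>c\<close> is joined to everything except \<open>w\<close>, and
  \<open>w\<close> hangs at \<open>u\<close>. So \<open>c\<close>, \<open>u\<close>,
  \<open>w\<close> go to 1, 0, 2, and the other vertices go to the pendent vertices at 1 in any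
  order.\<close>

lemma isomorphic_double_starI:
  assumes V: "finite (vertices T)" "c \<in> vertices T" "u \<in> vertices T" "w \<in> vertices T" "distinct [c, u, w]"
    and adj: "\<And>i j. i \<in> vertices T \<Longrightarrow> j \<in> vertices T \<Longrightarrow>
      adjacent T i j \<longleftrightarrow> {i, j} = {u, w} \<or> i \<noteq> j \<and> c \<in> {i, j} \<and> w \<notin> {i, j}"
  shows "isomorphic T (double_star 1 (card (vertices T) - 3))"
proof -
  define b where "b = card (vertices T) - 3"
  have "card {c, u, w} \<le> card (vertices T)"
    using V by (intro card_mono) auto
  then have n: "card (vertices T) = b + 3"
    using V(5) by (simp add: b_def)
  have "card (vertices T - {c, u, w}) = card {3..<b + 3}"
    using V n by (simp add: card_Diff_subset)
  then obtain g where g: "bij_betw g (vertices T - {c, u, w}) {3..<b + 3}"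
    using V(1) finite_same_card_bij by (metis finite_Diff finite_atLeastLessThan)
  define f where "f = g(c := 1, u := 0, w := 2)"
  have "bij_betw f (vertices T - {c, u, w}) {3..<b + 3}"
    using g by (rule bij_betw_cong[THEN iffD1, rotated]) (auto simp: f_def)
  moreover have "bij_betw f {c, u, w} {1, 0, 2}"
    using V(5) by (auto simp: f_def bij_betw_def inj_on_def)
  ultimately have "bij_betw f ((vertices T - {c, u, w}) \<union> {c, u, w}) ({3..<b + 3} \<union> {1, 0, 2})"
    by (intro bij_betw_combine) auto
  moreover have "(vertices T - {c, u, w}) \<union> {c, u, w} = vertices T"
    using V by auto
  moreover have "{3..<b + 3} \<union> {1, 0, 2} = vertices (double_star 1 b)"
    by (auto simp: double_star_def)
  ultimately have f: "bij_betw f (vertices T) (vertices (double_star 1 b))"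
    by simp
  have g3: "g i \<in> {3..<b + 3}" if "i \<in> vertices T" "i \<noteq> c" "i \<noteq> u" "i \<noteq> w" for i
    using g that by (auto simp: bij_betw_def)
  have fi: "f c = 1" "f u = 0" "f w = 2"
    using V(5) by (auto simp: f_def)
  have f3: "f i \<in> {3..<b + 3}" if "i \<in> vertices T" "i \<noteq> c" "i \<noteq> u" "i \<noteq> w" for i
    using g3[OF that] that by (simp add: f_def)
  have "adjacent T i j \<longleftrightarrow> adjacent (double_star 1 b) (f i) (f j)"
    if ij: "i \<in> vertices T" "j \<in> vertices T" for i j
  proof -
    have cases_T: "i = c \<or> i = u \<or> i = w \<or> (i \<notin> {c, u, w} \<and> f i \<in> {3..<b + 3})"
      "j = c \<or> j = u \<or> j = w \<or> (j \<notin> {c, u, w} \<and> f j \<in> {3..<b + 3})"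
      using f3 ij by auto
    show ?thesis
      unfolding adj[OF ij] adjacent_double_star
      using cases_T V(5) by (elim disjE) (auto simp: fi doubleton_eq_iff)
  qed
  then show ?thesis
    unfolding isomorphic_def b_def[symmetric] using f by blast
qed

text \<open>Every vertex has a walk to 1, and two such walks are joined there. There is no cycle,
  since its at least three vertices would each need two neighbours, and only 0 and 1 can have
  two.\<close>

lemma tree_graph_double_star: "tree_graph (double_star 1 b)"
proof -
  define G where "G = double_star 1 b"
  have V: "vertices G = {..<b + 3}"
    by (simp add: G_def double_star_def)
  have simple: "simple_graph G"
    by (auto simp: G_def simple_graph_def double_star_def)
  have adj: "adjacent G 0 1" "adjacent G 1 0" "adjacent G 2 0" "adjacent G 0 2"
    unfolding G_def adjacent_double_star by blast+
  have adj_1: "adjacent G 1 k" "adjacent G k 1" if "k \<in> {3..<b + 3}" for k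
    using that unfolding G_def adjacent_double_star by blast+
  have to_1: "\<exists>p. walk G p \<and> hd p = u \<and> last p = 1 \<and> walk G (rev p)" if "u \<in> vertices G" for u
  proof -
    have u: "u < b + 3"
      using that V by simp
    consider "u = 0" | "u = 1" | "u = 2" | "u \<in> {3..<b + 3}"
      using u by fastforce
    then show ?thesis
    proof cases
      case 1
      then show ?thesis
        by (intro exI[of _ "[0, 1]"]) (auto simp: walk_def V adj adj_1 simp del: One_nat_def)
    next
      case 2
      then show ?thesis
        by (intro exI[of _ "[1]"]) (auto simp: walk_def V adj adj_1 simp del: One_nat_def)
    next
      case 3
      then show ?thesis
        by (intro exI[of _ "[2, 0, 1]"]) (auto simp: walk_def V adj adj_1 simp del: One_nat_def)
    next
      case 4
      then show ?thesis
        by (intro exI[of _ "[u, 1]"]) (auto simp: walk_def V adj adj_1 simp del: One_nat_def)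
    qed
  qed
  have "\<exists>p. walk G p \<and> hd p = u \<and> last p = v" if uv: "u \<in> vertices G" "v \<in> vertices G" for u v
  proof -
    obtain p q where p: "walk G p" "hd p = u" "last p = 1" and q: "walk G (rev q)" "hd q = v" "last q = 1"
      using to_1[OF uv(1)] to_1[OF uv(2)] by blast
    have ne: "p \<noteq> []" "q \<noteq> []"
      using p q by (auto simp: walk_def)
    \<comment> \<open>The reversed walk starts at 1, where \<open>p\<close> ends; this repeated
      vertex is dropped before joining.\<close>
    obtain r where r: "rev q = 1 # r"
      using q ne by (metis hd_rev list.collapse rev_is_Nil_conv)
    then have succ_r: "successively (adjacent G) (1 # r)" "set r \<subseteq> vertices G"
      using q(1) by (auto simp: walk_def)
    have "walk G (p @ r)"
      using p ne succ_r by (auto simp: walk_def successively_append_iff successively_Cons)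
    moreover have "last (p @ r) = v"
      using r q(2) p(3) ne by (metis append_Nil2 hd_rev last.simps last_appendR last_rev)
    ultimately show ?thesis
      using p(2) ne by (intro exI[of _ "p @ r"]) simp
  qed
  then have "connected_graph G"
    by (auto simp: connected_graph_def V lessThan_empty_iff)
  moreover have False if cyc: "cycle G p" for p
  proof -
    have "v \<in> {0, 1}" if v: "v \<in> set p" for v
    proof -
      obtain x y where "x \<noteq> y" "adjacent G v x" "adjacent G v y"
        using cycle_two_neighbours[OF cyc v] by blast
      then show ?thesis
        unfolding G_def adjacent_double_star by (auto simp: doubleton_eq_iff)
    qed
    then have "card (set p) \<le> card {0, 1 :: nat}"
      by (intro card_mono) auto
    moreover have "card (set p) \<ge> 3"
      using cyc by (simp add: cycle_def distinct_card)
    ultimately show False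
      by simp
  qed
  ultimately show ?thesis
    using simple unfolding tree_graph_def G_def by blast
qed

lemma spanning_tree_of_double_star:
  assumes "n \<ge> 3"
  shows "spanning_tree_of (double_star 1 (n - 3)) (complete_graph n)"
proof -
  have "tree_graph (double_star 1 (n - 3))"
    by (rule tree_graph_double_star)
  moreover have "vertices (double_star 1 (n - 3)) = {..<n}"
    using assms by (auto simp: double_star_def)
  ultimately show ?thesis
    unfolding spanning_tree_of_def complete_graph_def by (auto simp: tree_graph_def simple_graph_def)
qed

text \<open>The triangle 0, 2, 3 has the single negative edge {0, 2}; vertex 3 exists because n is
  at least 4.\<close>

lemma unbalanced_double_star:
  assumes "n \<ge> 4"
  shows "\<not> balanced (signed_complete n (double_star 1 (n - 3)))"
proof -
  let ?S = "signed_complete n (double_star 1 (n - 3))" and ?p = "[0, 2, 3 :: nat]"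
  have "cycle (fst ?S) ?p"
    using assms by (auto simp: cycle_def walk_def signed_complete_def complete_graph_def adjacent_def)
  moreover have "{e \<in> cycle_edges ?p. snd ?S e = -1} = {{0, 2}}"
  proof -
    have "{{?p ! i, ?p ! Suc i} |i. Suc i < length ?p} = (\<lambda>i. {?p ! i, ?p ! Suc i}) ` {i. Suc i < length ?p}"
      by blast
    moreover have "{i. Suc i < length ?p} = {0, 1}"
      by auto
    ultimately have "cycle_edges ?p = {{0, 2}, {2, 3}, {3, 0}}"
      by (auto simp: cycle_edges_def)
    moreover have "{0, 2} \<in> edges (double_star 1 (n - 3))" "{2, 3} \<notin> edges (double_star 1 (n - 3))"
      "{3, 0} \<notin> edges (double_star 1 (n - 3))"
      using adjacent_double_star[of "n - 3" 0 2] adjacent_double_star[of "n - 3" 2 3]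
        adjacent_double_star[of "n - 3" 3 0]
      by (auto simp: adjacent_def doubleton_eq_iff)
    ultimately show ?thesis
      by (auto simp: signed_complete_def)
  qed
  ultimately show ?thesis
    by (auto simp: balanced_def positive_cycle_def)
qed

section \<open>Trees that are not stars\<close>

lemma adjacent_path_graph:
  "adjacent (path_graph n) i j \<longleftrightarrow> i < n \<and> j < n \<and> (i = Suc j \<or> j = Suc i)"
  unfolding adjacent_def path_graph_def by (auto simp: doubleton_eq_iff)

text \<open>The second assumption, that no vertex is joined to all others, is the combinatorial form
  in which unbalancedness enters.\<close>

locale nonstar_tree =
  fixes T :: "'a ugraph"
  assumes tree: "tree_graph T"
    and nonstar: "\<And>c. c \<in> vertices T \<Longrightarrow> \<exists>v\<in>vertices T. v \<noteq> c \<and> \<not> adjacent T c v"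
begin

abbreviation "V \<equiv> vertices T"
abbreviation "E \<equiv> adjacent T"

lemma finite_V: "finite V"
  using tree by (simp add: tree_graph_def simple_graph_def)

lemma E_sym: "E a b \<longleftrightarrow> E b a"
  by (rule adjacent_commute)

lemma E_irrefl: "\<not> E a a"
  using tree adjacent_irrefl[of T a] by (simp add: tree_graph_def)

lemma E_V: "E a b \<Longrightarrow> a \<in> V" "E a b \<Longrightarrow> b \<in> V"
  using tree adjacent_vertices by (auto simp: tree_graph_def)

lemma E_neq: "E a b \<Longrightarrow> a \<noteq> b"
  using E_irrefl by auto

lemma crossing:
  assumes "X \<subseteq> V" "X \<noteq> {}" "v \<in> V" "v \<notin> X"
  obtains x y where "x \<in> X" "y \<in> V" "y \<notin> X" "E x y"
proof -
  have "connected_graph T"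
    using tree by (simp add: tree_graph_def)
  then obtain x y where "x \<in> X" "y \<in> V - X" "E x y"
    using connected_graph_crossing[of T X v] assms by blast
  then show ?thesis
    using that by blast
qed

lemma neighbour:
  assumes "a \<in> V" "b \<in> V" "a \<noteq> b"
  obtains c where "E a c" "c \<noteq> a"
  using crossing[of "{a}" b] assms by auto

lemma acyclic: "\<not> cycle T p"
  using tree by (simp add: tree_graph_def)

lemma no_C3: "E a b \<Longrightarrow> E b c \<Longrightarrow> E c a \<Longrightarrow> False"
  using acyclic[of "[a, b, c]"] E_V E_irrefl by (auto simp: cycle_def walk_def)

text \<open>Consecutive vertices differ by irreflexivity, so only the two diagonals have to be
  assumed distinct.\<close>

lemma no_C4: "E a b \<Longrightarrow> E b c \<Longrightarrow> E c d \<Longrightarrow> E d a \<Longrightarrow> a \<noteq> c \<Longrightarrow> b \<noteq> d \<Longrightarrow> False"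
  using acyclic[of "[a, b, c, d]"] E_V E_irrefl by (auto simp: cycle_def walk_def)

lemma no_C5: "E a b \<Longrightarrow> E b c \<Longrightarrow> E c d \<Longrightarrow> E d e \<Longrightarrow> E e a \<Longrightarrow> distinct [a, b, c, d, e] \<Longrightarrow> False"
  using acyclic[of "[a, b, c, d, e]"] E_V by (auto simp: cycle_def walk_def)

section \<open>Short paths and the trees of order five\<close>

lemma two_neighbours:
  assumes "card V \<ge> 3"
  obtains c x y where "E c x" "E c y" "x \<noteq> y"
proof -
  obtain a X where a: "V = insert a X" "a \<notin> X" "2 \<le> card X" "finite X"
    using assms finite_V card_le_Suc_iff[of 2 V] by (auto simp: numeral_3_eq_3 numeral_2_eq_2)
  then obtain b where b: "b \<in> V" "b \<noteq> a"
    by (metis all_not_in_conv card.empty insertCI not_numeral_le_zero)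
  then obtain d where d: "E a d" "d \<noteq> a"
    using neighbour[of a b] a by auto
  have "V \<noteq> {a, d}"
  proof
    assume "V = {a, d}"
    then have "card V \<le> 2"
      by (simp add: card_insert_if)
    then show False
      using assms by simp
  qed
  then obtain v where v: "v \<in> V" "v \<notin> {a, d}"
    using E_V[OF d(1)] by blast
  obtain x y where "x \<in> {a, d}" "y \<notin> {a, d}" "E x y"
    by (rule crossing[of "{a, d}" v]) (use v E_V[OF d(1)] in auto)
  then show ?thesis
    using d(1) that[of a d y] that[of d a y] E_sym[of a d] by auto
qed

text \<open>Let \<open>c\<close> have two neighbours. Some edge p - q leaves the closed
  neighbourhood of \<open>c\<close>, and with a neighbour \<open>z\<close> of \<open>c\<close> other
  than \<open>p\<close> this gives the path q - p - c - z.\<close>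

lemma path_4:
  assumes "card V \<ge> 3"
  obtains a b c d where "E a b" "E b c" "E c d" "distinct [a, b, c, d]"
proof -
  obtain c x y where c: "E c x" "E c y" "x \<noteq> y"
    using two_neighbours[OF assms] .
  then obtain v where v: "v \<in> V" "v \<noteq> c" "\<not> E c v"
    using nonstar[of c] E_V[OF c(1)] by blast
  obtain p q where "p \<in> insert c {z. E c z}" "q \<in> V" "q \<notin> insert c {z. E c z}" "E p q"
    by (rule crossing[of "insert c {z. E c z}" v]) (use v E_V[OF c(1)] E_V(2)[of c] in auto)
  then have pq: "E c p" "E p q" "q \<noteq> c" "\<not> E c q"
    by auto
  obtain z where z: "E c z" "z \<noteq> p"
    using c by metis
  have "distinct [q, p, c, z]"
    using pq z E_neq[OF pq(1)] E_neq[OF pq(2)] E_neq[OF z(1)] by auto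
  then show ?thesis
    using that[of q p c z] pq z E_sym[of q p] E_sym[of p c] by blast
qed

text \<open>Four vertices form a path, and the fifth is joined to one of them: to an end, which
  gives the path on five vertices, or to an inner vertex, which gives the double star.\<close>

lemma order_5:
  assumes "card V = 5"
  shows "isomorphic T (double_star 1 2) \<or> isomorphic T (path_graph 5)"
proof -
  have path5: "isomorphic T (path_graph 5)"
    if p: "E a b" "E b c" "E c d" "E d e" "distinct [a, b, c, d, e]" "V = {a, b, c, d, e}" for a b c d e
  proof -
    define f where "f = (\<lambda>_. 0 :: nat)(b := 1, c := 2, d := 3, e := 4)"
    have f: "f a = 0" "f b = 1" "f c = 2" "f d = 3" "f e = 4"
      using p(5) by (auto simp: f_def)
    have "bij_betw f V {..<5}"
      using p(5,6) f by (auto simp: bij_betw_def inj_on_def)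
    moreover have "E i j \<longleftrightarrow> adjacent (path_graph 5) (f i) (f j)" if "i \<in> V" "j \<in> V" for i j
    proof -
      \<comment> \<open>Each further edge would close a cycle of length 3, 4 or 5.\<close>
      have "\<not> E a c" "\<not> E b d" "\<not> E c e" "\<not> E a d" "\<not> E b e" "\<not> E a e"
        using p no_C3[of a b c] no_C3[of b c d] no_C3[of c d e] no_C4[of a b c d] no_C4[of b c d e]
          no_C5[of a b c d e] E_sym[of a c] E_sym[of b d]
          E_sym[of c e] E_sym[of a d] E_sym[of b e] E_sym[of a e]
        by auto
      then have "E i j \<longleftrightarrow> f i = Suc (f j) \<or> f j = Suc (f i)"
        using that p(1-4) f E_sym E_irrefl unfolding p(6) by auto
      moreover have "f i < 5" "f j < 5"
        using that f unfolding p(6) by auto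
      ultimately show ?thesis
        by (simp add: adjacent_path_graph)
    qed
    ultimately show ?thesis
      unfolding isomorphic_def by (auto simp: path_graph_def)
  qed
  have star: "isomorphic T (double_star 1 2)"
    if p: "E a b" "E b c" "E c d" "E b e" "distinct [a, b, c, d, e]" "V = {a, b, c, d, e}" for a b c d e
  proof -
    have ne: "\<not> E a c" "\<not> E b d" "\<not> E c e" "\<not> E a d" "\<not> E e d" "\<not> E a e"
      using p no_C3[of a b c] no_C3[of b c d] no_C3[of e b c] no_C3[of a b e] no_C4[of a b c d]
        no_C4[of e b c d] E_sym[of a c] E_sym[of b d] E_sym[of e c] E_sym[of a d] E_sym[of e d]
        E_sym[of e a] E_sym[of e b]
      by auto
    have "isomorphic T (double_star 1 (card V - 3))"
    proof (rule isomorphic_double_starI[of _ b c d])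
      fix i j assume "i \<in> V" "j \<in> V"
      then show "E i j \<longleftrightarrow> {i, j} = {c, d} \<or> i \<noteq> j \<and> b \<in> {i, j} \<and> d \<notin> {i, j}"
        using p ne E_sym E_irrefl unfolding p(6) by (auto simp: doubleton_eq_iff)
    qed (use p finite_V in auto)
    then show ?thesis
      using assms by simp
  qed
  obtain a b c d where p: "E a b" "E b c" "E c d" "distinct [a, b, c, d]"
    by (rule path_4) (use assms in auto)
  have "card (V - {a, b, c, d}) = 1"
    using p E_V[OF p(1)] E_V[OF p(3)] assms finite_V by (subst card_Diff_subset) auto
  then obtain e where e: "V - {a, b, c, d} = {e}"
    using card_1_singletonE by blast
  then have V: "V = {a, b, c, d, e}" "e \<notin> {a, b, c, d}"
    using e E_V[OF p(1)] E_V[OF p(3)] by blast+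
  obtain x where x: "E e x" "x \<in> {a, b, c, d}"
    by (rule neighbour[of e a]) (use V E_V(2)[of e] in auto)
  have sym: "E b a" "E c b" "E d c" "E x e"
    using p(1-3) x(1) by (simp_all add: E_sym)
  from x(2) consider "x = a" | "x = b" | "x = c" | "x = d"
    by auto
  then show ?thesis
  proof cases
    case 1
    then show ?thesis
      using path5[of e a b c d] p x V by auto
  next
    case 2
    then show ?thesis
      using star[of a b c d e] p sym V by auto
  next
    case 3
    then show ?thesis
      using star[of d c b a e] p sym V by auto
  next
    case 4
    then show ?thesis
      using path5[of a b c d e] p sym V by auto
  qed
qed

section \<open>Sign classes and negative pairs\<close>

lemma common_neighbours_le_1:
  assumes "a \<noteq> b" "E a x" "E b x" "E a y" "E b y"
  shows "x = y"
  using no_C4[of a x b y] assms E_sym[of b x] E_sym[of a y] by blast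

text \<open>Pigeonhole: if neither sign class has four elements, both have exactly three, and there
  are six vertices in all.\<close>

lemma side_cases:
  assumes "card V \<ge> 6"
  obtains s a b c e where "{a, b, c, e} \<subseteq> V" "distinct [a, b, c, e]" "d a = s" "d b = s" "d c = s" "d e = (s :: bool)"
  | a1 a2 a3 b1 b2 b3 where "V = {a1, a2, a3, b1, b2, b3}" "distinct [a1, a2, a3, b1, b2, b3]"
    "d a1" "d a2" "d a3" "\<not> d b1" "\<not> d b2" "\<not> d b3"
proof -
  note four_case = that(1) and three_case = that(2)
  let ?A = "{i \<in> V. d i}" and ?B = "{i \<in> V. \<not> d i}"
  have four: thesis if X: "X \<subseteq> V" "card X \<ge> 4" "\<And>i. i \<in> X \<Longrightarrow> d i = s" for X s
  proof -
    obtain Y where "Y \<subseteq> X" "card Y = 4"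
      using X(2) obtain_subset_with_card_n by metis
    then obtain a b c e where "Y = {a, b, c, e}" "distinct [a, b, c, e]"
      by (auto simp: card_Suc_eq numeral_eq_Suc)
    then show thesis
      using four_case[of a b c e s] X \<open>Y \<subseteq> X\<close> by auto
  qed
  have "?A \<union> ?B = V" "?A \<inter> ?B = {}"
    by auto
  then have sum: "card ?A + card ?B = card V"
    using finite_V card_Un_disjoint[of ?A ?B] by simp
  show thesis
  proof (cases "card ?A \<ge> 4 \<or> card ?B \<ge> 4")
    case True
    then show thesis
    proof
      assume "card ?A \<ge> 4"
      then show thesis
        by (rule four[rotated]) auto
    next
      assume "card ?B \<ge> 4"
      then show thesis
        by (rule four[rotated]) auto
    qed
  next
    case False
    then have "card ?A = 3" "card ?B = 3"
      using sum assms by auto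
    then obtain a1 a2 a3 b1 b2 b3 where ab: "?A = {a1, a2, a3}" "distinct [a1, a2, a3]"
      "?B = {b1, b2, b3}" "distinct [b1, b2, b3]"
      unfolding card_3_iff distinct_length_2_or_more by (metis distinct_singleton)
    have d: "d a1" "d a2" "d a3" "\<not> d b1" "\<not> d b2" "\<not> d b3"
      using ab by blast+
    have "V = {a1, a2, a3} \<union> {b1, b2, b3}"
      using ab by blast
    then have "V = {a1, a2, a3, b1, b2, b3}"
      by auto
    moreover have "distinct [a1, a2, a3, b1, b2, b3]"
      using ab(2,4) d by auto
    ultimately show thesis
      using d by (intro three_case)
  qed
qed

text \<open>
  \<open>d\<close> records the signs of an eigenvector of \<open>A\<close> (if \<open>p\<close>) or of \<open>-A\<close> (if not \<open>p\<close>); the negative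
  pairs are those with entry \<open>-1\<close> after conjugating that matrix with these signs.
\<close>

definition negative :: "bool \<Rightarrow> ('a \<Rightarrow> bool) \<Rightarrow> 'a \<Rightarrow> 'a \<Rightarrow> bool" where
  "negative p d i j \<longleftrightarrow> i \<noteq> j \<and> ((E i j \<longleftrightarrow> d i = d j) \<longleftrightarrow> p)"

lemma negative_sym: "negative p d i j \<longleftrightarrow> negative p d j i"
  using E_sym by (auto simp: negative_def)

text \<open>The negative pairs form a matching.\<close>

definition cherry_free :: "bool \<Rightarrow> ('a \<Rightarrow> bool) \<Rightarrow> bool" where
  "cherry_free p d \<longleftrightarrow> (\<forall>w\<in>V. \<forall>u\<in>V. \<forall>v\<in>V. negative p d w u \<and> negative p d w v \<longrightarrow> u = v)"

lemma cherry_freeD: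
  assumes "cherry_free p d" "w \<in> V" "u \<in> V" "v \<in> V" "negative p d w u" "u \<noteq> v"
  shows "\<not> negative p d w v"
  using assms unfolding cherry_free_def by blast

text \<open>Here the negative pairs are the edges within a class and the non-edges between classes.
  So each vertex is adjacent to all but at most one vertex of the other class, which soon produces
  two vertices with two common neighbours.\<close>

lemma cherry_free_negative_True:
  assumes free: "cherry_free True d" and n: "card V \<ge> 6" and i: "i \<in> V"
  shows "\<exists>j\<in>V. negative True d i j"
proof -
  have N: "negative True d i j \<longleftrightarrow> i \<noteq> j \<and> (E i j \<longleftrightarrow> d i = d j)" for i j
    by (simp add: negative_def)
  have other: "E p x \<or> E p y"
    if "p \<in> V" "x \<in> V" "y \<in> V" "x \<noteq> y" "d x \<noteq> d p" "d y \<noteq> d p" for p x y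
    using cherry_freeD[OF free that(1-3) _ that(4)] that by (auto simp: N)
  show ?thesis
  using side_cases[OF n, of d]
  proof cases
    case (1 s a b c e)
    consider (many) p q where "p \<in> V" "q \<in> V" "p \<noteq> q" "d p \<noteq> s" "d q \<noteq> s"
      | (none) "\<And>x. x \<in> V \<Longrightarrow> d x = s"
      | (one) p where "p \<in> V" "d p \<noteq> s" "\<And>x. x \<in> V \<Longrightarrow> x \<noteq> p \<Longrightarrow> d x = s"
      by metis
    then have False
    proof cases
      case many
      \<comment> \<open>Both \<open>p\<close> and \<open>q\<close> are adjacent to at least three of
        the four vertices, hence share two neighbours.\<close>
      have "E p x \<or> E p y" "E q x \<or> E q y" if "x \<in> {a, b, c, e}" "y \<in> {a, b, c, e}" "x \<noteq> y" for x y
        using other[of p x y] other[of q x y] that many 1 by auto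
      then have E: "E p a \<or> E p b" "E p a \<or> E p c" "E p a \<or> E p e" "E p b \<or> E p c" "E p b \<or> E p e"
        "E p c \<or> E p e" "E q a \<or> E q b" "E q a \<or> E q c" "E q a \<or> E q e" "E q b \<or> E q c"
        "E q b \<or> E q e" "E q c \<or> E q e"
        using 1(2) by auto
      have "\<not> (E p x \<and> E q x \<and> E p y \<and> E q y)" if "x \<noteq> y" for x y
        using common_neighbours_le_1[of p q x y] many(3) that by blast
      then have "\<not> (E p a \<and> E q a \<and> E p b \<and> E q b)" "\<not> (E p a \<and> E q a \<and> E p c \<and> E q c)"
        "\<not> (E p a \<and> E q a \<and> E p e \<and> E q e)" "\<not> (E p b \<and> E q b \<and> E p c \<and> E q c)"
        "\<not> (E p b \<and> E q b \<and> E p e \<and> E q e)" "\<not> (E p c \<and> E q c \<and> E p e \<and> E q e)"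
        using 1(2) by auto
      then show False
        using E by argo
    next
      case none
      \<comment> \<open>With a single class every edge of \<open>T\<close> is negative, and two
        edges at a vertex violate the matching.\<close>
      obtain p x y where p: "E p x" "E p y" "x \<noteq> y"
        by (rule two_neighbours) (use n in auto)
      then show False
        using cherry_freeD[OF free, of p x y] none E_V[OF p(1)] E_V[OF p(2)] E_neq[OF p(1)] E_neq[OF p(2)]
        by (auto simp: N)
    next
      case one
      \<comment> \<open>The non-edge from \<open>w\<close> to \<open>p\<close> and any edge at
        \<open>w\<close> are two negative pairs at \<open>w\<close>.\<close>
      obtain w where w: "w \<in> V" "w \<noteq> p" "\<not> E p w"
        using nonstar[OF one(1)] by blast
      obtain x where x: "E w x" "x \<noteq> w"
        by (rule neighbour[of w p]) (use w one(1) in auto)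
      have "x \<in> V" "x \<noteq> p"
        using x w E_V[OF x(1)] E_sym[of w p] by auto
      then show False
        using cherry_freeD[OF free, of w p x] w x one E_sym[of w p] by (auto simp: N)
    qed
    then show ?thesis ..
  next
    case (2 a1 a2 a3 b1 b2 b3)
    \<comment> \<open>If \<open>p\<close> were adjacent to the whole opposite class, it would share
      two neighbours with \<open>q\<close>. The missing edge is the negative pair sought.\<close>
    have miss: "\<exists>j\<in>{x, y, z}. \<not> E p j"
      if "p \<noteq> q" "distinct [x, y, z]" "{p, q, x, y, z} \<subseteq> V" "d q = d p" "d x \<noteq> d p" "d y \<noteq> d p" "d z \<noteq> d p"
      for p q x y z
    proof (rule ccontr)
      assume "\<not> ?thesis"
      then have "E p x" "E p y" "E p z"
        by auto
      moreover have "E q x \<or> E q y" "E q y \<or> E q z" "E q x \<or> E q z"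
        using other[of q x y] other[of q y z] other[of q x z] that by auto
      ultimately show False
        using common_neighbours_le_1[of p q x y] common_neighbours_le_1[of p q y z]
          common_neighbours_le_1[of p q x z] that(1,2) by auto
    qed
    have "\<exists>j\<in>{b1, b2, b3}. \<not> E i j" if "i \<in> {a1, a2, a3}"
      using that miss[of a1 a2 b1 b2 b3] miss[of a2 a1 b1 b2 b3] miss[of a3 a1 b1 b2 b3] 2 by auto
    moreover have "\<exists>j\<in>{a1, a2, a3}. \<not> E i j" if "i \<in> {b1, b2, b3}"
      using that miss[of b1 b2 a1 a2 a3] miss[of b2 b1 a1 a2 a3] miss[of b3 b1 a1 a2 a3] 2 by auto
    moreover have "i \<in> {a1, a2, a3} \<or> i \<in> {b1, b2, b3}"
      using i 2(1) by auto
    moreover have "negative True d x y" if "\<not> E x y"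
      "x \<in> {a1, a2, a3} \<and> y \<in> {b1, b2, b3} \<or> x \<in> {b1, b2, b3} \<and> y \<in> {a1, a2, a3}" for x y
      using that 2 by (auto simp: N)
    moreover have "{a1, a2, a3} \<subseteq> V" "{b1, b2, b3} \<subseteq> V"
      using 2(1) by auto
    ultimately show ?thesis
      by blast
  qed
qed

text \<open>Now the negative pairs are the non-edges within a class and the edges between classes.
  Four vertices of one class span a complete graph minus a matching, which contains a triangle or a
  quadrilateral; so the classes have three elements each.\<close>

lemma cherry_free_negative_False:
  assumes free: "cherry_free False d" and n: "card V \<ge> 6" and i: "i \<in> V"
  shows "\<exists>j\<in>V. negative False d i j"
proof -
  have N: "negative False d i j \<longleftrightarrow> i \<noteq> j \<and> (E i j \<longleftrightarrow> d i \<noteq> d j)" for i j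
    by (auto simp: negative_def)
  have same: "E p x \<or> E p y"
    if "p \<in> V" "x \<in> V" "y \<in> V" "distinct [p, x, y]" "d x = d p" "d y = d p" for p x y
    using cherry_freeD[OF free that(1-3), of] that by (auto simp: N)
  show ?thesis
  using side_cases[OF n, of d]
  proof cases
    case (1 s a b c e)
    have same': "E p x \<or> E p y"
      if "p \<in> {a, b, c, e}" "x \<in> {a, b, c, e}" "y \<in> {a, b, c, e}" "distinct [p, x, y]" for p x y
      using same[of p x y] that 1 by auto
    have "E a b \<or> E a c" "E a b \<or> E a e" "E a c \<or> E a e" "E b a \<or> E b c" "E b a \<or> E b e"
      "E b c \<or> E b e" "E c a \<or> E c b" "E c a \<or> E c e" "E c b \<or> E c e" "E e a \<or> E e b" "E e a \<or> E e c"
      "E e b \<or> E e c"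
      by (rule same'; use 1(2) in auto)+
    moreover have "E b a = E a b" "E c a = E a c" "E e a = E a e" "E c b = E b c" "E e b = E b e" "E e c = E c e"
      by (rule E_sym)+
    moreover have "\<not> (E a b \<and> E b c \<and> E c a)" "\<not> (E a b \<and> E b e \<and> E e a)" "\<not> (E a c \<and> E c e \<and> E e a)"
      "\<not> (E b c \<and> E c e \<and> E e b)"
      using no_C3[of a b c] no_C3[of a b e] no_C3[of a c e] no_C3[of b c e] by blast+
    moreover have "\<not> (E a b \<and> E b c \<and> E c e \<and> E e a)" "\<not> (E a b \<and> E b e \<and> E e c \<and> E c a)"
      "\<not> (E a c \<and> E c b \<and> E b e \<and> E e a)"
      using no_C4[of a b c e] no_C4[of a b e c] no_C4[of a c b e] 1(2) by auto
    ultimately have False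
      by argo
    then show ?thesis ..
  next
    case (2 a1 a2 a3 b1 b2 b3)
    have side: "\<exists>p q r. {x, y, z} = {p, q, r} \<and> negative False d p q"
      if "distinct [x, y, z]" "d y = d x" "d z = d x" for x y z
    proof -
      consider "\<not> E x y" | "\<not> E y z" | "\<not> E z x"
        using no_C3[of x y z] by blast
      then show ?thesis
      proof cases
        case 1
        then show ?thesis
          using that by (intro exI[of _ x] exI[of _ y] exI[of _ z]) (auto simp: N)
      next
        case 2
        then show ?thesis
          using that by (intro exI[of _ y] exI[of _ z] exI[of _ x]) (auto simp: N)
      next
        case 3
        then show ?thesis
          using that by (intro exI[of _ z] exI[of _ x] exI[of _ y]) (auto simp: N)
      qed
    qed
    obtain p q r where pqr: "{a1, a2, a3} = {p, q, r}" "negative False d p q"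
      using side[of a1 a2 a3] 2 by auto
    obtain p' q' r' where pqr': "{b1, b2, b3} = {p', q', r'}" "negative False d p' q'"
      using side[of b1 b2 b3] 2 by auto
    have V: "V = {p, q, r} \<union> {p', q', r'}"
      using 2(1) pqr(1) pqr'(1) by auto
    have d: "d j" if "j \<in> {p, q, r}" for j
      using that 2 unfolding pqr(1)[symmetric] by auto
    have d': "\<not> d j" if "j \<in> {p', q', r'}" for j
      using that 2 unfolding pqr'(1)[symmetric] by auto
    have p': "p' \<notin> {p, q, r}"
      using d d'[of p'] by blast
    obtain x y where xy: "x \<in> {p, q, r}" "y \<in> V" "y \<notin> {p, q, r}" "E x y"
      by (rule crossing[of "{p, q, r}" p']) (use V p' in auto)
    then have y: "y \<in> {p', q', r'}"
      using V by blast
    have Nxy: "negative False d x y"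
      using xy(4) d[OF xy(1)] d'[OF y] E_neq[OF xy(4)] by (simp add: N)
    have "x \<noteq> p" "x \<noteq> q"
      using cherry_freeD[OF free, of p q y] cherry_freeD[OF free, of q p y] pqr(2) Nxy xy V
        negative_sym[of False d p q] by blast+
    moreover have "y \<noteq> p'" "y \<noteq> q'"
      using cherry_freeD[OF free, of p' q' x] cherry_freeD[OF free, of q' p' x] pqr'(2) Nxy xy y V
        negative_sym[of False d p' q'] negative_sym[of False d x y] d d' by blast+
    ultimately have "x = r" "y = r'"
      using xy y by auto
    then show ?thesis
      using i V pqr(2) pqr'(2) Nxy negative_sym[of False d p q] negative_sym[of False d p' q']
        negative_sym[of False d x y] by auto
  qed
qed

text \<open>Within a class and away from \<open>w\<close> all pairs are edges of \<open>T\<close>.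
  Some class has three vertices other than \<open>w\<close>, and these form a triangle.\<close>

lemma negative_at_vertex_False:
  assumes n: "card V \<ge> 6"
    and only: "\<And>i j. i \<in> V \<Longrightarrow> j \<in> V \<Longrightarrow> negative False d i j \<Longrightarrow> i = w \<or> j = w"
  shows False
proof -
  have tri: False if "distinct [x, y, z]" "{x, y, z} \<subseteq> V" "w \<notin> {x, y, z}" "d y = d x" "d z = d x" for x y z
  proof -
    have "E x y" "E y z" "E z x"
      using only[of x y] only[of y z] only[of z x] that by (auto simp: negative_def)
    then show False
      by (rule no_C3)
  qed
  show False
    using side_cases[OF n, of d]
  proof cases
    case (1 s a b c e)
    then show False
      using tri[of a b c] tri[of a b e] tri[of a c e] tri[of b c e] by auto
  next
    case (2 a1 a2 a3 b1 b2 b3)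
    then show False
      using tri[of a1 a2 a3] tri[of b1 b2 b3] by auto
  qed
qed

text \<open>Away from \<open>w\<close>, \<open>T\<close> is complete bipartite between the sign
  classes. Having no quadrilateral, it has at most one vertex \<open>p\<close> on one side; this
  \<open>p\<close> becomes the large centre, and \<open>w\<close> hangs at one of its
  neighbours.\<close>

lemma negative_at_vertex_True:
  assumes n: "card V \<ge> 6" and w: "w \<in> V"
    and only: "\<And>i j. i \<in> V \<Longrightarrow> j \<in> V \<Longrightarrow> negative True d i j \<Longrightarrow> i = w \<or> j = w"
  shows "isomorphic T (double_star 1 (card V - 3))"
proof -
  have E: "E i j \<longleftrightarrow> d i \<noteq> d j" if "i \<in> V" "j \<in> V" "i \<noteq> w" "j \<noteq> w" for i j
    using only[OF that(1,2)] that E_irrefl by (auto simp: negative_def)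
  have sq: False if "p \<noteq> q" "x \<noteq> y" "{p, q, x, y} \<subseteq> V" "w \<notin> {p, q, x, y}" "d p = s" "d q = s" "d x \<noteq> s" "d y \<noteq> s"
    for p q x y s
  proof -
    have "E p x" "E q x" "E p y" "E q y"
      using E[of p x] E[of q x] E[of p y] E[of q y] that by auto
    then show False
      using common_neighbours_le_1[of p q x y] that(1,2) by blast
  qed
  show ?thesis
    using side_cases[OF n, of d]
  proof cases
    case (1 s a b c e)
    consider (many) p q where "p \<in> V" "q \<in> V" "p \<noteq> q" "p \<noteq> w" "q \<noteq> w" "d p \<noteq> s" "d q \<noteq> s"
      | (none) "\<And>x. x \<in> V \<Longrightarrow> x \<noteq> w \<Longrightarrow> d x = s"
      | (one) p where "p \<in> V" "p \<noteq> w" "d p \<noteq> s" "\<And>x. x \<in> V \<Longrightarrow> x \<noteq> w \<Longrightarrow> x \<noteq> p \<Longrightarrow> d x = s"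
      by metis
    then show ?thesis
    proof cases
      case many
      then have False
        using sq[of a b p q s] sq[of a c p q s] sq[of b c p q s] 1 by auto
      then show ?thesis ..
    next
      case none
      \<comment> \<open>With one class only, all edges contain \<open>w\<close>, so a vertex not
        adjacent to \<open>w\<close> would be isolated.\<close>
      obtain z where z: "z \<in> V" "z \<noteq> w" "\<not> E w z"
        using nonstar[OF w] by blast
      obtain x where x: "E z x" "x \<noteq> z"
        by (rule neighbour[of z w]) (use z w in auto)
      then have "x \<in> V" "x \<noteq> w"
        using z E_V[OF x(1)] E_sym[of z w] by auto
      then have False
        using E[of z x] none z x by auto
      then show ?thesis ..
    next
      case one
      have p: "E p x" if "x \<in> V" "x \<noteq> w" "x \<noteq> p" for x
        using E[of p x] one that by auto
      have pw: "\<not> E p w"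
        using nonstar[OF one(1)] p by blast
      obtain x where x: "E w x" "x \<noteq> w"
        by (rule neighbour[of w p]) (use w one in auto)
      have xV: "x \<in> V" "x \<noteq> p"
        using x pw E_V[OF x(1)] E_sym[of w p] by auto
      \<comment> \<open>All neighbours of \<open>w\<close> are also neighbours of
        \<open>p\<close>.\<close>
      have uniq: "y = x" if "E w y" for y
      proof -
        have "y \<in> V" "y \<noteq> w" "y \<noteq> p"
          using that pw E_V[OF that] E_neq[OF that] E_sym[of w p] by auto
        then show ?thesis
          using common_neighbours_le_1[of p w y x] one(2) that x p xV by auto
      qed
      show ?thesis
      proof (rule isomorphic_double_starI[of _ p x w])
        fix i j assume ij: "i \<in> V" "j \<in> V"
        have rest: "\<not> E i j" if "i \<notin> {p, w}" "j \<notin> {p, w}"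
          using E[OF ij] one(4) ij that by auto
        show "E i j \<longleftrightarrow> {i, j} = {x, w} \<or> i \<noteq> j \<and> p \<in> {i, j} \<and> w \<notin> {i, j}"
        proof (cases "i = w \<or> j = w")
          case True
          moreover have "E w j \<longleftrightarrow> j = x" "E i w \<longleftrightarrow> i = x"
            using x(1) uniq E_sym[of i w] by blast+
          ultimately show ?thesis
            using x(2) by (auto simp: doubleton_eq_iff)
        next
          case False
          have "E i j" if "i \<noteq> j" "p \<in> {i, j}"
            using that False p[OF ij(1)] p[OF ij(2)] E_sym[of p i] by blast
          moreover have "{i, j} \<noteq> {x, w}"
            using False by (auto simp: doubleton_eq_iff)
          ultimately show ?thesis
            using False rest E_neq[of i j] by auto
        qed
      qed (use finite_V one w xV x in auto)
    qed
  next
    case (2 a1 a2 a3 b1 b2 b3)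
    have "\<exists>p q. p \<noteq> q \<and> {p, q} \<subseteq> V \<and> w \<notin> {p, q} \<and> d p \<and> d q"
      using 2 by (cases "w = a1"; cases "w = a2") auto
    moreover have "\<exists>p q. p \<noteq> q \<and> {p, q} \<subseteq> V \<and> w \<notin> {p, q} \<and> \<not> d p \<and> \<not> d q"
      using 2 by (cases "w = b1"; cases "w = b2") auto
    ultimately obtain p q x y where "p \<noteq> q" "{p, q} \<subseteq> V" "w \<notin> {p, q}" "d p" "d q"
      "x \<noteq> y" "{x, y} \<subseteq> V" "w \<notin> {x, y}" "\<not> d x" "\<not> d y"
      by (elim exE conjE)
    then have False
      using sq[of p q x y True] by auto
    then show ?thesis ..
  qed
qed

end

section \<open>Maximizers of the spectral radius\<close>

text \<open>If \<open>c\<close> were joined to all other vertices, an edge avoiding \<open>c\<close>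
  would close a triangle; so the edges would be exactly the pairs containing \<open>c\<close>, and
  this star is balanced.\<close>

lemma unbalanced_nonstar_tree:
  assumes T: "spanning_tree_of T (complete_graph n)" and unbalanced: "\<not> balanced (signed_complete n T)"
  shows "nonstar_tree T"
proof
  have V: "vertices T = {..<n}" and edges: "edges T \<subseteq> {e. e \<subseteq> {..<n} \<and> card e = 2}"
    using T by (auto simp: spanning_tree_of_def complete_graph_def)
  show tree: "tree_graph T"
    using T by (simp add: spanning_tree_of_def)
  fix c assume c: "c \<in> vertices T"
  show "\<exists>v\<in>vertices T. v \<noteq> c \<and> \<not> adjacent T c v"
  proof (rule ccontr)
    assume "\<not> ?thesis"
    then have star: "adjacent T c v" if "v < n" "v \<noteq> c" for v
      using that V by auto
    have "e \<in> edges T \<longleftrightarrow> e \<subseteq> {..<n} \<and> card e = 2 \<and> c \<in> e" for e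
    proof
      assume e: "e \<in> edges T"
      then obtain x y where xy: "e = {x, y}" "x \<noteq> y" "x < n" "y < n"
        using edges by (auto simp: card_2_iff)
      have "c \<in> e"
      proof (rule ccontr)
        assume "c \<notin> e"
        then have "cycle T [c, x, y]"
          using e xy c V star[of x] star[of y] adjacent_commute[of T y c]
          by (auto simp: cycle_def walk_def adjacent_def)
        then show False
          using tree by (simp add: tree_graph_def)
      qed
      then show "e \<subseteq> {..<n} \<and> card e = 2 \<and> c \<in> e"
        using e edges by auto
    next
      assume e: "e \<subseteq> {..<n} \<and> card e = 2 \<and> c \<in> e"
      then obtain v where "e = {c, v}" "v \<noteq> c"
        by (auto simp: card_2_iff)
      then show "e \<in> edges T"
        using e star[of v] by (simp add: adjacent_def)
    qed
    then show False
      using star_balanced unbalanced by blast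
  qed
qed

text \<open>Row \<open>i\<close> of the identity A = J - I - 2N, with N the indicator of the
  negative pairs.\<close>

lemma sum_negative_entries:
  fixes x :: "'a \<Rightarrow> real"
  assumes "finite V" "i \<in> V" "\<not> N i i"
  shows "(\<Sum>j\<in>V. (if i = j then 0 else if N i j then -1 else 1) * x j) =
    sum x V - x i - 2 * (\<Sum>j | j \<in> V \<and> N i j. x j)"
proof -
  have "(\<Sum>j\<in>V. (if i = j then 0 else if N i j then -1 else 1) * x j) =
      (\<Sum>j\<in>V. x j - (if j = i then x j else 0) - 2 * (if N i j then x j else 0))"
    using assms(3) by (intro sum.cong) auto
  also have "\<dots> = sum x V - (\<Sum>j\<in>V. if j = i then x j else 0) - 2 * (\<Sum>j\<in>V. if N i j then x j else 0)"
    by (simp add: sum_subtractf sum_distrib_left)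
  finally show ?thesis
    using assms by (simp add: sum.inter_filter)
qed

text \<open>Switching at vertex 1 makes its edges to 0 and to the pendent vertices positive and the
  pair {1, 2} negative. What remains negative is the cherry 0 - 2 - 1, so \<open>L - 1\<close> is an
  eigenvalue.\<close>

lemma rho_double_star_ge:
  assumes n: "n \<ge> 6" and L: "threshold n L"
  shows "L - 1 \<le> rho (adjacency_matrix (signed_complete n (double_star 1 (n - 3))))"
proof (rule eigenvalue_le_rho)
  let ?A = "adjacency_matrix (signed_complete n (double_star 1 (n - 3)))"
  show A: "?A \<in> carrier_mat n n"
    by (simp add: adjacency_matrix_signed_complete)
  obtain y :: "nat \<Rightarrow> real" where y: "\<And>i. i \<in> {..<n} \<Longrightarrow> y i > 0"
    "\<And>i. i \<in> {..<n} \<Longrightarrow>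
      L * y i = sum y {..<n} - 2 * (\<Sum>j | j \<in> {..<n} \<and> cherry 2 0 1 i j. y j)"
    by (rule cherry_positive_eigenvector[of "{..<n}" 2 0 1 n L]) (use n L in auto)
  define e :: "nat \<Rightarrow> real" where "e i = (if i = 1 then -1 else 1)" for i
  have switch: "?A $$ (i, j) * (e j * y j) =
      e i * ((if i = j then 0 else if cherry 2 0 1 i j then -1 else 1) * y j)"
    if "i < n" "j < n" for i j
  proof -
    have "i \<in> {0, 1, 2} \<or> i \<in> {3..<n - 3 + 3}" "j \<in> {0, 1, 2} \<or> j \<in> {3..<n - 3 + 3}"
      using that by auto
    then have "adjacent (double_star 1 (n - 3)) i j \<longleftrightarrow> (cherry 2 0 1 i j \<longleftrightarrow> e i = e j) \<and> i \<noteq> j"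
      unfolding adjacent_double_star
      by (elim disjE) (auto simp: cherry_def e_def doubleton_eq_iff)
    then show ?thesis
      using that by (auto simp: adjacency_matrix_signed_complete e_def)
  qed
  have "(\<Sum>j<n. ?A $$ (i, j) * (e j * y j)) = (L - 1) * (e i * y i)" if i: "i < n" for i
  proof -
    have "(\<Sum>j<n. ?A $$ (i, j) * (e j * y j)) =
        e i * (\<Sum>j<n. (if i = j then 0 else if cherry 2 0 1 i j then -1 else 1) * y j)"
      unfolding sum_distrib_left using switch i by (intro sum.cong) auto
    also have "(\<Sum>j<n. (if i = j then 0 else if cherry 2 0 1 i j then -1 else 1) * y j) = L * y i - y i"
      using sum_negative_entries[of "{..<n}" i "cherry 2 0 1" y] y(2)[of i] i
      by (auto simp: cherry_def)
    finally show ?thesis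
      by (simp add: algebra_simps)
  qed
  moreover have "e 0 * y 0 \<noteq> 0"
    using y(1)[of 0] n by (simp add: e_def)
  ultimately show "eigenvalue ?A (L - 1)"
    unfolding eigenvalue_iff_sum[OF A] using n
    by (intro exI[of _ "\<lambda>i. e i * y i"] conjI exI[of _ 0]) auto
qed

context
  fixes T :: "nat ugraph"
  assumes nonstar_tree: "nonstar_tree T"
begin

interpretation nonstar_tree T
  by (rule nonstar_tree)

text \<open>Replacing an eigenvector by its absolute value amounts to switching by its signs.\<close>

lemma rho_switched:
  fixes n :: nat
  defines "R \<equiv> rho (adjacency_matrix (signed_complete n T)) + 1"
  assumes V: "vertices T = {..<n}" and n: "n > 0"
  obtains p d and z :: "nat \<Rightarrow> real" and m where "\<And>i. z i \<ge> 0" "m < n" "z m > 0"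
    "\<And>i. i < n \<Longrightarrow> R * z i = sum z {..<n} - 2 * (\<Sum>j | j \<in> {..<n} \<and> negative p d i j. z j)"
proof -
  let ?A = "adjacency_matrix (signed_complete n T)"
  have A: "?A \<in> carrier_mat n n"
    by (simp add: adjacency_matrix_signed_complete)
  have A_entry: "?A $$ (i, j) = (if i = j then 0 else if E i j then -1 else 1)" if "i < n" "j < n" for i j
    using that by (simp add: adjacency_matrix_signed_complete)
  obtain \<sigma> :: real and x where \<sigma>: "\<sigma> = 1 \<or> \<sigma> = -1" and "\<exists>i<n. x i \<noteq> 0"
    and x: "\<And>i. i < n \<Longrightarrow> (\<Sum>j<n. \<sigma> * ?A $$ (i, j) * x j) = rho ?A * x i"
    by (rule rho_attained[OF A n]) (auto simp: A_entry E_sym)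
  then obtain m where m: "m < n" "x m \<noteq> 0"
    by blast
  define p where "p \<longleftrightarrow> \<sigma> = 1"
  \<comment> \<open>Zero entries count as positive, so that \<open>e\<close> only takes the values 1
    and -1.\<close>
  define d where "d i \<longleftrightarrow> x i \<ge> 0" for i
  define e where "e i = (if d i then 1 else -1 :: real)" for i
  have abs: "\<bar>x i\<bar> = e i * x i" for i
    by (simp add: e_def d_def)
  have ee: "e j * e j = 1" for j
    by (simp add: e_def)
  have entry: "e i * (\<sigma> * ?A $$ (i, j)) * e j = (if i = j then 0 else if negative p d i j then -1 else 1)"
    if "i < n" "j < n" for i j
    using \<sigma> unfolding A_entry[OF that] by (auto simp: negative_def e_def p_def)
  have "(rho ?A + 1) * \<bar>x i\<bar> =
      (\<Sum>j<n. \<bar>x j\<bar>) - 2 * (\<Sum>j | j \<in> {..<n} \<and> negative p d i j. \<bar>x j\<bar>)" if i: "i < n" for i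
  proof -
    have "rho ?A * \<bar>x i\<bar> = e i * (\<Sum>j<n. \<sigma> * ?A $$ (i, j) * x j)"
      by (simp add: x[OF i] abs)
    also have "\<dots> = (\<Sum>j<n. (e i * (\<sigma> * ?A $$ (i, j)) * e j) * (e j * x j))"
      unfolding sum_distrib_left by (intro sum.cong refl) (simp add: ee mult.assoc flip: mult.assoc[of "e _" "e _"])
    also have "\<dots> = (\<Sum>j<n. (if i = j then 0 else if negative p d i j then -1 else 1) * \<bar>x j\<bar>)"
      using i by (intro sum.cong refl) (simp only: entry lessThan_iff abs)
    also have "\<dots> = (\<Sum>j<n. \<bar>x j\<bar>) - \<bar>x i\<bar> - 2 * (\<Sum>j | j \<in> {..<n} \<and> negative p d i j. \<bar>x j\<bar>)"
      using i by (intro sum_negative_entries) (auto simp: negative_def)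
    finally show ?thesis
      by (simp add: algebra_simps)
  qed
  then show ?thesis
    using that[of "\<lambda>i. \<bar>x i\<bar>" m p d] m by (simp add: R_def)
qed

lemma maximizer_double_star:
  fixes n :: nat
  assumes V: "vertices T = {..<n}" and n: "n \<ge> 6" and L: "threshold n L"
    and ge: "L - 1 \<le> rho (adjacency_matrix (signed_complete n T))"
  shows "isomorphic T (double_star 1 (n - 3))"
proof -
  define R where "R = rho (adjacency_matrix (signed_complete n T)) + 1"
  have R: "L \<le> R"
    using ge by (simp add: R_def)
  have card: "card {..<n} = n" "card (vertices T) = n" "card (vertices T) \<ge> 6"
    using n V by auto
  obtain p d and z :: "nat \<Rightarrow> real" and m where z: "\<And>i. z i \<ge> 0" "m < n" "z m > 0"
    and eig: "\<And>i. i < n \<Longrightarrow> R * z i = sum z {..<n} - 2 * (\<Sum>j | j \<in> {..<n} \<and> negative p d i j. z j)"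
    unfolding R_def by (rule rho_switched[OF V]) (use n in auto)
  \<comment> \<open>A matching would cover every vertex, and then \<open>R\<close> would be at most
    n - 1, below \<open>L\<close>.\<close>
  have "\<not> cherry_free p d"
  proof
    assume free: "cherry_free p d"
    have "\<exists>j\<in>{..<n}. j \<noteq> i \<and> negative p d i j" if "i \<in> {..<n}" for i
    proof -
      have "\<exists>j\<in>vertices T. negative p d i j"
        using free cherry_free_negative_True[OF _ card(3)] cherry_free_negative_False[OF _ card(3)] that V
        by (cases p) auto
      then show ?thesis
        using V by (auto simp: negative_def)
    qed
    then have "R \<le> real n - 1"
      using z eig by (intro negative_neighbour_bound[of "{..<n}" n z m R "negative p d"]) auto
    then show False
      using R L by (simp add: threshold_def)
  qed
  then obtain w u v where w: "w \<in> {..<n}" "u \<in> {..<n}" "v \<in> {..<n}" "u \<noteq> v"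
    "negative p d w u" "negative p d w v"
    unfolding cherry_free_def V by blast
  then have "distinct [w, u, v]"
    by (auto simp: negative_def)
  then have "negative p d i j \<longleftrightarrow> cherry w u v i j" if "i \<in> {..<n}" "j \<in> {..<n}" for i j
    using w z eig that negative_sym
    by (intro cherry_dominates[of "{..<n}" w u v n L R "negative p d" z m]) (auto simp: n L R)
  then have only: "i = w \<or> j = w" if "i \<in> vertices T" "j \<in> vertices T" "negative p d i j" for i j
    using that V by (auto simp: cherry_def)
  show ?thesis
  proof (cases p)
    case True
    then show ?thesis
      using negative_at_vertex_True[OF card(3), of w d] only w(1) V card(2) by auto
  next
    case False
    then show ?thesis
      using negative_at_vertex_False[OF card(3), of d w] only by auto
  qed
qed

end

theorem theorem3:
  fixes n :: nat and T :: "nat ugraph"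
  assumes "spanning_tree_of T (complete_graph n)"
    and "\<not> balanced (signed_complete n T)"
    and "\<And>T'. \<lbrakk>spanning_tree_of T' (complete_graph n); \<not> balanced (signed_complete n T')\<rbrakk> \<Longrightarrow>
           rho (adjacency_matrix (signed_complete n T'))
             \<le> rho (adjacency_matrix (signed_complete n T))"
  shows "(n = 5 \<longrightarrow> isomorphic T (double_star 1 2) \<or> isomorphic T (path_graph 5)) \<and>
         (n \<ge> 6 \<longrightarrow> isomorphic T (double_star 1 (n - 3)))"
proof -
  have T: "nonstar_tree T"
    using assms(1,2) by (rule unbalanced_nonstar_tree)
  have V: "vertices T = {..<n}"
    using assms(1) by (simp add: spanning_tree_of_def complete_graph_def)
  have "isomorphic T (double_star 1 (n - 3))" if n: "n \<ge> 6"
  proof -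
    obtain L where L: "threshold n L"
      using threshold_exists[OF n] by blast
    \<comment> \<open>The double star is itself a competitor, so a maximizer reaches its spectral
      radius.\<close>
    have "L - 1 \<le> rho (adjacency_matrix (signed_complete n (double_star 1 (n - 3))))"
      by (rule rho_double_star_ge[OF n L])
    also have "\<dots> \<le> rho (adjacency_matrix (signed_complete n T))"
      using n by (intro assms(3) spanning_tree_of_double_star unbalanced_double_star) auto
    finally show ?thesis
      by (rule maximizer_double_star[OF T V n L])
  qed
  then show ?thesis
    using nonstar_tree.order_5[OF T] V by auto
qed

end
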